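(* Let $n\geq 4$ and let $p\in\mathcal{H}$. Let $d$ be the degree of $p$ and let $N=N(p)$ be the number of nonzero coefficients of $p$. Then $$ d=\frac{N-1}{n-1} $$ holds if and only if $p$ is a sharp generalized Whitney polynomial.
   Context: Write $s=x_1+\cdots+x_n$. $\mathcal{H}$ denotes the set of polynomials $p$ in $x_1,\dots,x_n$ with non-negative coefficients that satisfy $p=1$ on the hyperplane $x_1+\cdots+x_n=1$. A polynomial is called a sharp generalized Whitney polynomial if it is obtained from $s$ by finitely many (possibly zero) steps of the following kind: given the current polynomial $p$, of degree $d$, choose a term $m=c\,x^\alpha$ of $p$ of maximal degree $|\alpha|=d$, where $c>0$ is the full coefficient of $x^\alpha$ in $p$, and replace $p$ by $p-m+s\cdot m$.
   Formalization: The polynomial p is assumed nonconstant (d ≥ 1): the constant p = 1 lies in H and satisfies d = 0 = (N−1)/(n−1), but it is not a sharp generalized Whitney polynomial, since these start from s and have degree at least 1. *)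

theory Defs
  imports Complex_Main "HOL-Library.Poly_Mapping"
begin

text \<open>
  A real polynomial is a finitely supported map from exponent vectors to coefficients, with the
  convolution product of \<^theory>\<open>HOL-Library.Poly_Mapping\<close>. The variables
  \<open>x\<^sub>1, \<dots>, x\<^sub>n\<close> have the indices \<open>0, \<dots>, n - 1\<close>.
\<close>

type_synonym rpoly = "(nat \<Rightarrow>\<^sub>0 nat) \<Rightarrow>\<^sub>0 real"

definition polys_in :: "nat \<Rightarrow> rpoly set" where
  "polys_in n = {p. \<forall>\<alpha>\<in>Poly_Mapping.keys p. Poly_Mapping.keys \<alpha> \<subseteq> {..<n}}"

definition poly_eval :: "rpoly \<Rightarrow> (nat \<Rightarrow> real) \<Rightarrow> real" where
  "poly_eval p x = (\<Sum>\<alpha>\<in>Poly_Mapping.keys p. Poly_Mapping.lookup p \<alpha> *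
     (\<Prod>i\<in>Poly_Mapping.keys \<alpha>. x i ^ Poly_Mapping.lookup \<alpha> i))"

definition expo_degree :: "(nat \<Rightarrow>\<^sub>0 nat) \<Rightarrow> nat" where
  "expo_degree \<alpha> = (\<Sum>i\<in>Poly_Mapping.keys \<alpha>. Poly_Mapping.lookup \<alpha> i)"

text \<open>By convention the zero polynomial has total degree 0.\<close>

definition total_degree :: "rpoly \<Rightarrow> nat" where
  "total_degree p = Max (insert 0 (expo_degree ` Poly_Mapping.keys p))"

definition num_terms :: "rpoly \<Rightarrow> nat" where
  "num_terms p = card (Poly_Mapping.keys p)"

definition coord :: "nat \<Rightarrow> rpoly" where
  "coord i = Poly_Mapping.single (Poly_Mapping.single i 1) 1"

definition coord_sum :: "nat \<Rightarrow> rpoly" where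
  "coord_sum n = (\<Sum>i<n. coord i)"

text \<open>Only the values \<open>x 0, \<dots>, x (n - 1)\<close> of a point \<open>x\<close> matter below, as \<open>p \<in> polys_in n\<close>.\<close>

definition H_set :: "nat \<Rightarrow> rpoly set" where
  "H_set n = {p \<in> polys_in n. (\<forall>\<alpha>. 0 \<le> Poly_Mapping.lookup p \<alpha>) \<and>
     (\<forall>x. (\<Sum>i<n. x i) = 1 \<longrightarrow> poly_eval p x = 1)}"

inductive sharp_whitney :: "nat \<Rightarrow> rpoly \<Rightarrow> bool" for n :: nat where
  start: "sharp_whitney n (coord_sum n)"
| step: "sharp_whitney n p \<Longrightarrow> expo_degree \<alpha> = total_degree p \<Longrightarrow>
     0 < Poly_Mapping.lookup p \<alpha> \<Longrightarrow> m = Poly_Mapping.single \<alpha> (Poly_Mapping.lookup p \<alpha>) \<Longrightarrow>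
     sharp_whitney n (p - m + coord_sum n * m)"

end

theory Submission
  imports Defs
begin

text \<open>
  Write \<open>s\<close> for the sum of the variables, \<open>p\<^sub>k\<close> for the part of \<open>p\<close> of degree \<open>k\<close>, and
  \<open>(p - 1) / (s - 1) = q\<^sub>0 + \<dots> + q\<^sub>d\<^sub>-\<^sub>1\<close> with \<open>q\<^sub>k\<close> homogeneous of degree \<open>k\<close>. Then
  \<open>q\<^sub>0 = 1 - p\<^sub>0\<close>, \<open>q\<^sub>k\<^sub>+\<^sub>1 = s q\<^sub>k - p\<^sub>k\<^sub>+\<^sub>1\<close> and \<open>q\<^sub>d = 0\<close>. So a nonzero form is multiplied by \<open>s\<close> again
  and again, and the only way to bring it back to \<open>0\<close> is to subtract terms of \<open>p\<close>. The number of these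
  terms is bounded below by an integer potential \<open>\<Psi>\<close> that vanishes at \<open>0\<close>, equals \<open>n\<close> at every
  monomial, and satisfies, for each step \<open>g' = s g - P\<close> of the recursion,
  \<open>n #P \<ge> n (n - 1) + \<Psi>(g) - \<Psi>(g')\<close>, where \<open>#P\<close> is the number of terms of \<open>P\<close>
  (\<open>growth_step.step_bound\<close>). Summing over the \<open>d\<close> steps gives \<open>N(p) \<ge> d (n - 1) + 1\<close>
  (\<open>H_poly.sum_gap\<close>).

  The potential looks at the Newton polytope. For a pair \<open>i \<noteq> j\<close> choose a generic weight that vanishes on
  \<open>x\<^sub>i\<close> and \<open>x\<^sub>j\<close> and is positive on the other variables; the terms of \<open>g\<close> of smallest weight lie on an
  edge parallel to \<open>e\<^sub>i - e\<^sub>j\<close> (possibly a single point), and on it \<open>g\<close> is a monomial times a form in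
  \<open>x\<^sub>i, x\<^sub>j\<close>. Multiplication by \<open>s\<close> multiplies this form by \<open>x\<^sub>i + x\<^sub>j\<close>. Count the maximal runs of
  consecutive terms with alternating signs. Multiplication by \<open>x\<^sub>i + x\<^sub>j\<close> increases the number of runs
  (\<open>alt_blocks_add_shift\<close>), a change of one coefficient decreases it by at most two, and removing an end
  of the edge decreases it by at most one. Each edge is counted for \<open>(i, j)\<close> and for \<open>(j, i)\<close>, so a term
  of \<open>P\<close> inside an edge is charged at most \<open>4\<close>, and this is at most \<open>n\<close>. This is where \<open>n \<ge> 4\<close> enters.
  A term of \<open>P\<close> that removes the end of an edge towards \<open>x\<^sub>i\<close> may be charged by all \<open>n - 1\<close> edges
  \<open>(i, j)\<close>, if they share this end. To pay for that, \<open>\<Psi>\<close> also counts for every \<open>i\<close> the distinct ends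
  towards \<open>x\<^sub>i\<close>: when a shared end is removed, the edges that survive get pairwise distinct new ends
  (\<open>growth_step.num_tips_bound\<close>). If an edge is removed completely, there is enough to spare.

  Non-negativity of the coefficients of \<open>p\<close> gives \<open>q\<^sub>k \<noteq> 0\<close> for \<open>k < d\<close>, and, working backwards from
  \<open>q\<^sub>d = 0\<close>, it shows that the coefficients of \<open>q\<^sub>k\<close> at the ends of all these edges are
  positive and that no edge of \<open>q\<^sub>k\<^sub>+\<^sub>1\<close> lies outside the corresponding edge of \<open>s q\<^sub>k\<close>
  (\<open>growth_step.top_pos\<close>).

  If \<open>N(p) = d (n - 1) + 1\<close>, all steps are tight. Going backwards from \<open>q\<^sub>d = 0\<close> one shows that every
  \<open>q\<^sub>k\<close> is a monomial (\<open>tight_step.g_monomial\<close>). In a tight step the chosen edges of \<open>g\<close> are the edges of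
  a simplex \<open>c + m \<Delta>\<close>, and the terms of \<open>s g\<close> lie on the edges of \<open>c + (m + 1) \<Delta>\<close>. Apart from the edges
  at one vertex \<open>z\<close>, only the vertices of the larger simplex occur. Since \<open>s g\<close> vanishes where \<open>s = 0\<close>,
  putting \<open>x\<^sub>z = 0\<close> makes a sum of at least three terms \<open>a\<^sub>i x\<^sub>i\<^sup>m\<^sup>+\<^sup>1\<close> with positive coefficients vanish on
  \<open>s = 0\<close>, and this forces \<open>m = 0\<close>. A chain of monomials \<open>1 = q\<^sub>0, q\<^sub>1, \<dots>\<close> with coefficients \<open>1\<close>, each
  a term of \<open>s\<close> times the previous one, is the record of the choices that build a sharp generalized
  Whitney polynomial. The converse is a count: every Whitney step adds \<open>n - 1\<close> terms and raises the degree
  by one.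
\<close>

section \<open>Alternating blocks of a sequence of signs\<close>

text \<open>
  A block is a maximal run of consecutive nonzero entries whose signs alternate. Every nonzero entry opens a
  block unless it is preceded by an entry of the opposite sign, so the difference of the two cardinalities
  is the number of blocks.
\<close>

definition alt_blocks :: "(nat \<Rightarrow> real) \<Rightarrow> int" where
  "alt_blocks T = int (card {x. T x \<noteq> 0}) - int (card {x. T x * T (Suc x) < 0})"

text \<open>
  If \<open>T\<close> lists the coefficients of a binary form in \<open>x, y\<close>, then \<open>add_shift T\<close> lists those of its product
  with \<open>x + y\<close>.
\<close>

definition add_shift :: "(nat \<Rightarrow> real) \<Rightarrow> nat \<Rightarrow> real" where
  "add_shift T x = T x + (if x = 0 then 0 else T (x - 1))"

fun alt_blocks_upto :: "(nat \<Rightarrow> real) \<Rightarrow> nat \<Rightarrow> int" where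
  "alt_blocks_upto T 0 = of_bool (T 0 \<noteq> 0)"
| "alt_blocks_upto T (Suc m) = alt_blocks_upto T m + of_bool (T (Suc m) \<noteq> 0) - of_bool (T m * T (Suc m) < 0)"

lemma alt_blocks_upto_card:
  "alt_blocks_upto T m = int (card {x. x \<le> m \<and> T x \<noteq> 0}) - int (card {x. x < m \<and> T x * T (Suc x) < 0})"
proof (induction m)
  case 0
  have "{x. x \<le> 0 \<and> T x \<noteq> 0} = (if T 0 \<noteq> 0 then {0} else {})" by (auto intro!: gr0I)
  then show ?case by simp
next
  case (Suc m)
  have "{x. x \<le> Suc m \<and> T x \<noteq> 0} =
      (if T (Suc m) \<noteq> 0 then insert (Suc m) {x. x \<le> m \<and> T x \<noteq> 0} else {x. x \<le> m \<and> T x \<noteq> 0})"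
    by (auto simp: le_Suc_eq)
  moreover have "{x. x < Suc m \<and> T x * T (Suc x) < 0} =
      (if T m * T (Suc m) < 0 then insert m {x. x < m \<and> T x * T (Suc x) < 0}
       else {x. x < m \<and> T x * T (Suc x) < 0})"
    by (auto simp: less_Suc_eq)
  ultimately show ?case using Suc by simp
qed

lemma alt_blocks_upto_eq:
  assumes "\<And>x. x > m \<Longrightarrow> T x = 0"
  shows "alt_blocks_upto T m = alt_blocks T"
proof -
  have "{x. x \<le> m \<and> T x \<noteq> 0} = {x. T x \<noteq> 0}"
    using assms by (auto simp: not_le[symmetric])
  moreover have "{x. x < m \<and> T x * T (Suc x) < 0} = {x. T x * T (Suc x) < 0}"
  proof -
    have "T x * T (Suc x) = 0" if "\<not> x < m" for x
      using assms[of "Suc x"] that by simp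
    then show ?thesis by force
  qed
  ultimately show ?thesis unfolding alt_blocks_upto_card alt_blocks_def by simp
qed

text \<open>
  The induction step of the next lemma. Here \<open>a\<close> and \<open>b\<close> are consecutive entries of \<open>T\<close>, \<open>u\<close> is the entry of
  \<open>add_shift T\<close> at the position of \<open>a\<close>, so that \<open>a + b\<close> follows it, and \<open>D\<close> is the excess of blocks of
  \<open>add_shift T\<close> over those of \<open>T\<close> up to this position. A zero entry of \<open>T\<close>, or an entry of the product
  with the opposite sign, indicates that the gain of one block has already been made.
\<close>

lemma alt_blocks_sign_step:
  fixes a b u :: real and D :: int
  assumes "if a \<noteq> 0 \<and> a * u \<ge> 0 then D \<ge> 0 else D \<ge> 1"
  defines "D' \<equiv> D + of_bool (a + b \<noteq> 0) - of_bool (u * (a + b) < 0) - of_bool (b \<noteq> 0) + of_bool (a * b < 0)"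
  shows "if b \<noteq> 0 \<and> b * (a + b) \<ge> 0 then D' \<ge> 0 else D' \<ge> 1"
  using assms(1) unfolding D'_def
  by (cases a "0::real" rule: linorder_cases; cases b "0::real" rule: linorder_cases;
      cases u "0::real" rule: linorder_cases; cases "a + b" "0::real" rule: linorder_cases;
      simp add: mult_less_0_iff zero_le_mult_iff)

lemma alt_blocks_upto_add_shift:
  "if \<forall>x\<le>m. T x = 0 then alt_blocks_upto (add_shift T) m = alt_blocks_upto T m
   else if T m \<noteq> 0 \<and> T m * add_shift T m \<ge> 0 then alt_blocks_upto (add_shift T) m \<ge> alt_blocks_upto T m
   else alt_blocks_upto (add_shift T) m \<ge> alt_blocks_upto T m + 1"
proof (induction m)
  case 0
  then show ?case by (simp add: add_shift_def)
next
  case (Suc m)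
  have s: "add_shift T (Suc m) = T m + T (Suc m)" by (simp add: add_shift_def)
  show ?case
  proof (cases "\<forall>x\<le>m. T x = 0")
    case True
    then have "T m = 0" "add_shift T m = 0" by (auto simp: add_shift_def)
    then show ?thesis using Suc True s by (auto simp: le_Suc_eq)
  next
    case False
    then have "\<not> (\<forall>x\<le>Suc m. T x = 0)" by (meson le_SucI)
    moreover have "if T m \<noteq> 0 \<and> T m * add_shift T m \<ge> 0
      then alt_blocks_upto (add_shift T) m - alt_blocks_upto T m \<ge> 0
      else alt_blocks_upto (add_shift T) m - alt_blocks_upto T m \<ge> 1"
      using Suc False by (auto split: if_splits)
    note alt_blocks_sign_step[OF this, of "T (Suc m)"]
    ultimately show ?thesis by (auto simp: s split: if_splits)
  qed
qed

text \<open>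
  Just before a block the product has the sign of the first entry of the block, just after it the sign of
  the last entry. The parity of the distance between these two positions excludes that they belong to the
  same block of the product. So the blocks of \<open>T\<close> separate one more block of the product than there are
  blocks of \<open>T\<close>. The proof counts along prefixes instead.
\<close>

lemma alt_blocks_add_shift:
  assumes fin: "finite {x. T x \<noteq> 0}" and nz: "T y \<noteq> 0"
  shows "alt_blocks (add_shift T) \<ge> alt_blocks T + 1"
proof -
  obtain m where m: "\<And>x. T x \<noteq> 0 \<Longrightarrow> x < m"
    using fin finite_nat_set_iff_bounded by auto
  have "alt_blocks_upto T (Suc m) = alt_blocks T"
    by (rule alt_blocks_upto_eq) (meson m Suc_lessD not_less_iff_gr_or_eq)
  moreover have "alt_blocks_upto (add_shift T) (Suc m) = alt_blocks (add_shift T)"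
  proof (rule alt_blocks_upto_eq)
    fix x assume "Suc m < x"
    then have "\<not> x < m" "\<not> x - 1 < m" by auto
    then have "T x = 0" "T (x - 1) = 0" using m by blast+
    then show "add_shift T x = 0" by (simp add: add_shift_def)
  qed
  moreover have "T (Suc m) = 0" "y \<le> Suc m" using m[of "Suc m"] m[OF nz] by auto
  ultimately show ?thesis using alt_blocks_upto_add_shift[of "Suc m" T] nz by (auto split: if_splits)
qed

lemma finite_adj: "finite {x. T x \<noteq> (0::real)} \<Longrightarrow> finite {x. T x * T (Suc x) < 0}"
  by (rule finite_subset[rotated]) auto

lemma alt_blocks_pos:
  assumes fin: "finite {x. T x \<noteq> 0}" and nz: "T y \<noteq> 0"
  shows "alt_blocks T \<ge> 1"
proof -
  let ?S = "{x. T x \<noteq> 0}"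
  have ne: "?S \<noteq> {}" using nz by auto
  have "{x. T x * T (Suc x) < 0} \<subseteq> ?S - {Max ?S}"
  proof
    fix x assume "x \<in> {x. T x * T (Suc x) < 0}"
    then have "T x \<noteq> 0" "T (Suc x) \<noteq> 0" by auto
    moreover from this have "Suc x \<le> Max ?S" using fin by (intro Max_ge) auto
    ultimately show "x \<in> ?S - {Max ?S}" by auto
  qed
  then have "card {x. T x * T (Suc x) < 0} \<le> card (?S - {Max ?S})"
    using fin by (intro card_mono) auto
  moreover have "card (?S - {Max ?S}) + 1 = card ?S"
    using fin ne by (metis Max_in Suc_eq_plus1 card_Suc_Diff1)
  ultimately show ?thesis unfolding alt_blocks_def by linarith
qed

lemma alt_blocks_update_zero:
  assumes fin: "finite {x. T x \<noteq> 0}"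
  shows "alt_blocks (T(x := 0)) \<ge> alt_blocks T - 1"
proof -
  let ?T = "T(x := 0)"
  have fin': "finite {y. ?T y \<noteq> 0}" using fin by (rule finite_subset[rotated]) auto
  have "{y. T y \<noteq> 0} \<subseteq> insert x {y. ?T y \<noteq> 0}" by auto
  then have "card {y. T y \<noteq> 0} \<le> card (insert x {y. ?T y \<noteq> 0})"
    using fin' by (intro card_mono) auto
  then have "card {y. T y \<noteq> 0} \<le> card {y. ?T y \<noteq> 0} + 1"
    using fin' by (simp add: card_insert_if split: if_splits)
  moreover have "card {y. ?T y * ?T (Suc y) < 0} \<le> card {y. T y * T (Suc y) < 0}"
    by (intro card_mono finite_adj fin) auto
  ultimately show ?thesis unfolding alt_blocks_def by linarith
qed

text \<open>
  An entry belongs to two neighbouring pairs, so that a nonzero new value creates at most two sign changes,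
  while the value zero creates none and removes one entry.
\<close>

lemma alt_blocks_update:
  assumes fin: "finite {x. T x \<noteq> 0}"
  shows "alt_blocks (T(x := v)) \<ge> alt_blocks T - 2"
proof (cases "v = 0")
  case True
  then show ?thesis using alt_blocks_update_zero[OF fin, of x] by simp
next
  case False
  let ?T = "T(x := v)"
  have "{y. ?T y \<noteq> 0} = insert x {y. T y \<noteq> 0}" using False by auto
  then have "card {y. T y \<noteq> 0} \<le> card {y. ?T y \<noteq> 0}"
    using fin by (intro card_mono) auto
  moreover have "{y. ?T y * ?T (Suc y) < 0} \<subseteq> {y. T y * T (Suc y) < 0} \<union> {x, x - 1}"
    by auto
  then have "card {y. ?T y * ?T (Suc y) < 0} \<le> card ({y. T y * T (Suc y) < 0} \<union> {x, x - 1})"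
    by (intro card_mono) (auto intro: finite_adj fin)
  moreover have "card ({y. T y * T (Suc y) < 0} \<union> {x, x - 1}) \<le> card {y. T y * T (Suc y) < 0} + card {x, x-1}"
    by (rule card_Un_le)
  moreover have "card {x, x - 1} \<le> 2" by (simp add: card_insert_if)
  ultimately show ?thesis unfolding alt_blocks_def by linarith
qed

lemma alt_blocks_update_pos:
  assumes "T x > 0" "v \<ge> 0" and fin: "finite {x. T x \<noteq> 0}"
  shows "alt_blocks (T(x := v)) \<ge> alt_blocks T - of_bool (v = 0)"
proof (cases "v = 0")
  case True
  then show ?thesis using alt_blocks_update_zero[OF fin, of x] by simp
next
  case False
  let ?T = "T(x := v)"
  have "{y. ?T y \<noteq> 0} = {y. T y \<noteq> 0}" using False assms by auto
  moreover have "(?T y * ?T (Suc y) < 0) = (T y * T (Suc y) < 0)" for y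
    using assms False by (auto simp: mult_less_0_iff)
  ultimately show ?thesis using False unfolding alt_blocks_def by simp
qed

lemma alt_blocks_override:
  assumes "finite X" and "finite {x. U x \<noteq> 0}"
  shows "alt_blocks (override_on U T X) \<ge> alt_blocks U - 2 * int (card X)"
  using assms
proof (induction X rule: finite_induct)
  case empty
  then show ?case by simp
next
  case (insert x X)
  have "finite {y. override_on U T X y \<noteq> 0}"
    by (rule finite_subset[of _ "{y. U y \<noteq> 0} \<union> X"]) (use insert in \<open>auto simp: override_on_def\<close>)
  moreover have "override_on U T (insert x X) = (override_on U T X)(x := T x)"
    by (auto simp: override_on_def)
  ultimately have "alt_blocks (override_on U T (insert x X)) \<ge> alt_blocks (override_on U T X) - 2"
    using alt_blocks_update by metis
  then show ?case using insert by simp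
qed

text \<open>
  For the passage from an edge of \<open>s g\<close> to the same edge of \<open>g'\<close>: changes in the interior cost two, while the
  two positive ends cost one each, and only if they become zero.
\<close>

lemma alt_blocks_change:
  assumes fin: "finite {x. U x \<noteq> 0}" and X: "finite X" "\<And>x. x \<notin> X \<Longrightarrow> x \<noteq> lo \<Longrightarrow> x \<noteq> hi \<Longrightarrow> T x = U x"
    and notin: "lo \<notin> X" "hi \<notin> X"
    and lohi: "lo \<noteq> hi" "U lo > 0" "U hi > 0" "T lo \<ge> 0" "T hi \<ge> 0"
  shows "alt_blocks T \<ge> alt_blocks U - 2 * int (card X) - of_bool (T lo = 0) - of_bool (T hi = 0)"
proof -
  let ?W = "override_on U T X"
  have finW: "finite {y. ?W y \<noteq> 0}"
    by (rule finite_subset[of _ "{y. U y \<noteq> 0} \<union> X"]) (use fin X in \<open>auto simp: override_on_def\<close>)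
  have "finite {y. (?W(lo := T lo)) y \<noteq> 0}"
    by (rule finite_subset[of _ "insert lo {y. ?W y \<noteq> 0}"]) (use finW in auto)
  moreover have "(?W(lo := T lo)) hi > 0" "?W lo > 0"
    using lohi notin by (auto simp: override_on_def)
  moreover have "T = ?W(lo := T lo, hi := T hi)"
    using X by (auto simp: override_on_def fun_eq_iff)
  ultimately have "alt_blocks T \<ge> alt_blocks (?W(lo := T lo)) - of_bool (T hi = 0)"
    "alt_blocks (?W(lo := T lo)) \<ge> alt_blocks ?W - of_bool (T lo = 0)"
    using alt_blocks_update_pos[of "?W(lo := T lo)" hi "T hi"] alt_blocks_update_pos[of ?W lo "T lo"] lohi finW
    by auto
  with alt_blocks_override[OF X(1) fin, of T] show ?thesis by linarith
qed

section \<open>Exponents, multiplication by the sum of the variables, and evaluation\<close>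

definition var :: "nat \<Rightarrow> nat \<Rightarrow>\<^sub>0 nat" where
  "var i = Poly_Mapping.single i 1"

definition expos :: "nat \<Rightarrow> nat \<Rightarrow> (nat \<Rightarrow>\<^sub>0 nat) set" where
  "expos n k = {\<alpha>. Poly_Mapping.keys \<alpha> \<subseteq> {..<n} \<and> expo_degree \<alpha> = k}"

lemma lookup_var: "Poly_Mapping.lookup (var i) j = (if i = j then 1 else 0)"
  by (simp add: var_def lookup_single when_def)

lemma var_eq_iff [simp]: "var i = var j \<longleftrightarrow> i = j"
  by (metis lookup_var zero_neq_one)

lemma keys_plus_nat:
  fixes \<alpha> \<beta> :: "nat \<Rightarrow>\<^sub>0 nat"
  shows "Poly_Mapping.keys (\<alpha> + \<beta>) = Poly_Mapping.keys \<alpha> \<union> Poly_Mapping.keys \<beta>"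
  by (auto simp: in_keys_iff lookup_add)

lemma keys_var [simp]: "Poly_Mapping.keys (var i) = {i}"
  by (simp add: var_def)

lemma expo_degree_superset:
  assumes "finite A" "Poly_Mapping.keys \<alpha> \<subseteq> A"
  shows "expo_degree \<alpha> = (\<Sum>i\<in>A. Poly_Mapping.lookup \<alpha> i)"
  unfolding expo_degree_def using assms
  by (intro sum.mono_neutral_left) (auto simp: in_keys_iff)

lemma expo_degree_plus: "expo_degree (\<alpha> + \<beta>) = expo_degree \<alpha> + expo_degree \<beta>"
proof -
  let ?A = "Poly_Mapping.keys \<alpha> \<union> Poly_Mapping.keys \<beta>"
  have "expo_degree (\<alpha> + \<beta>) = (\<Sum>i\<in>?A. Poly_Mapping.lookup (\<alpha> + \<beta>) i)"
    by (rule expo_degree_superset) (auto simp: keys_plus_nat)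
  also have "\<dots> = (\<Sum>i\<in>?A. Poly_Mapping.lookup \<alpha> i) + (\<Sum>i\<in>?A. Poly_Mapping.lookup \<beta> i)"
    by (simp add: lookup_add sum.distrib)
  also have "\<dots> = expo_degree \<alpha> + expo_degree \<beta>"
    by (simp add: expo_degree_superset[of ?A])
  finally show ?thesis .
qed

lemma expo_degree_var [simp]: "expo_degree (var i) = 1"
  by (simp add: expo_degree_def lookup_var)

lemma expos_degree: "\<alpha> \<in> expos n k \<Longrightarrow> (\<Sum>i<n. Poly_Mapping.lookup \<alpha> i) = k"
  unfolding expos_def using expo_degree_superset[of "{..<n}" \<alpha>] by auto

lemma expos_lookup_le: "\<alpha> \<in> expos n k \<Longrightarrow> Poly_Mapping.lookup \<alpha> i \<le> k"
proof (cases "i < n")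
  case True
  assume "\<alpha> \<in> expos n k"
  from expos_degree[OF this] show ?thesis
    using member_le_sum[of i "{..<n}" "Poly_Mapping.lookup \<alpha>"] True by auto
next
  case False
  assume "\<alpha> \<in> expos n k"
  then have "i \<notin> Poly_Mapping.keys \<alpha>" using False by (auto simp: expos_def)
  then show ?thesis by (simp add: in_keys_iff)
qed

lemma expos_lookup_outside: "\<alpha> \<in> expos n k \<Longrightarrow> \<not> i < n \<Longrightarrow> Poly_Mapping.lookup \<alpha> i = 0"
  unfolding expos_def by (auto simp: in_keys_iff)

lemma expos_plus_var: "\<alpha> \<in> expos n k \<Longrightarrow> i < n \<Longrightarrow> \<alpha> + var i \<in> expos n (Suc k)"
  by (auto simp: expos_def keys_plus_nat expo_degree_plus)

lemma expos_eqI: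
  assumes "\<alpha> \<in> expos n k" "\<beta> \<in> expos n k" "j < n"
    and eq: "\<And>h. h < n \<Longrightarrow> h \<noteq> j \<Longrightarrow> Poly_Mapping.lookup \<alpha> h = Poly_Mapping.lookup \<beta> h"
  shows "\<alpha> = \<beta>"
proof (rule poly_mapping_eqI)
  have "(\<Sum>h\<in>{..<n}. Poly_Mapping.lookup \<alpha> h) = (\<Sum>h\<in>{..<n}. Poly_Mapping.lookup \<beta> h)"
    using expos_degree assms by metis
  moreover have "(\<Sum>h\<in>{..<n}-{j}. Poly_Mapping.lookup \<alpha> h) = (\<Sum>h\<in>{..<n}-{j}. Poly_Mapping.lookup \<beta> h)"
    by (intro sum.cong) (auto intro: eq)
  ultimately have "Poly_Mapping.lookup \<alpha> j = Poly_Mapping.lookup \<beta> j"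
    using \<open>j < n\<close> by (simp add: sum.remove[of "{..<n}" j])
  then show "Poly_Mapping.lookup \<alpha> h = Poly_Mapping.lookup \<beta> h" for h
    using eq expos_lookup_outside assms(1,2) by metis
qed

lemma minus_var_plus: "Poly_Mapping.lookup \<beta> i > 0 \<Longrightarrow> \<beta> - var i + var i = \<beta>"
  by (rule poly_mapping_eqI) (auto simp: lookup_add lookup_minus lookup_var)

lemma coord_eq: "coord i = Poly_Mapping.single (var i) 1"
  by (simp add: coord_def var_def)

lemma lookup_coord_mult_plus: "Poly_Mapping.lookup (coord i * g) (\<alpha> + var i) = Poly_Mapping.lookup g \<alpha>"
proof -
  have "Poly_Mapping.lookup (coord i * g) (\<alpha> + var i) =
      (\<Sum>l. (\<Sum>q. Poly_Mapping.lookup g q when \<alpha> + var i = l + q) when l = var i)"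
    unfolding lookup_mult coord_eq
    by (intro Sum_any.cong) (simp add: lookup_single when_def)
  also have "\<dots> = (\<Sum>q. Poly_Mapping.lookup g q when \<alpha> + var i = var i + q)"
    by simp
  also have "\<dots> = (\<Sum>q. Poly_Mapping.lookup g q when q = \<alpha>)"
    by (intro Sum_any.cong) (auto simp: add.commute when_def)
  finally show ?thesis by simp
qed

lemma lookup_coord_mult:
  "Poly_Mapping.lookup (coord i * g) \<beta> =
    (if Poly_Mapping.lookup \<beta> i > 0 then Poly_Mapping.lookup g (\<beta> - var i) else 0)"
proof (cases "Poly_Mapping.lookup \<beta> i > 0")
  case True
  then show ?thesis using lookup_coord_mult_plus[of i g "\<beta> - var i"] by (simp add: minus_var_plus)
next
  case False
  have "\<beta> \<notin> Poly_Mapping.keys (coord i * g)"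
  proof
    assume "\<beta> \<in> Poly_Mapping.keys (coord i * g)"
    then obtain q where "\<beta> = var i + q" using keys_mult[of "coord i" g] by (auto simp: coord_eq split: if_splits)
    then show False using False by (simp add: lookup_add lookup_var)
  qed
  then show ?thesis using False by (simp add: in_keys_iff)
qed

lemma lookup_coord_sum_mult:
  "Poly_Mapping.lookup (coord_sum n * g) \<beta> =
    (\<Sum>i<n. if Poly_Mapping.lookup \<beta> i > 0 then Poly_Mapping.lookup g (\<beta> - var i) else 0)"
  unfolding coord_sum_def by (simp add: sum_distrib_right lookup_sum lookup_coord_mult)

lemma keys_coord_sum_mult:
  assumes "\<beta> \<in> Poly_Mapping.keys (coord_sum n * g)"
  obtains \<alpha> i where "i < n" "\<alpha> \<in> Poly_Mapping.keys g" "\<beta> = \<alpha> + var i"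
proof -
  have "\<exists>i<n. Poly_Mapping.lookup \<beta> i > 0 \<and> Poly_Mapping.lookup g (\<beta> - var i) \<noteq> 0"
  proof (rule ccontr)
    assume *: "\<not> ?thesis"
    then have "Poly_Mapping.lookup (coord_sum n * g) \<beta> = 0"
      unfolding lookup_coord_sum_mult by (intro sum.neutral) auto
    then show False using assms by (simp add: in_keys_iff)
  qed
  then show ?thesis using that minus_var_plus by (metis in_keys_iff)
qed

lemma coord_sum_mult_expos:
  assumes "Poly_Mapping.keys g \<subseteq> expos n k"
  shows "Poly_Mapping.keys (coord_sum n * g) \<subseteq> expos n (Suc k)"
  using assms by (auto intro: expos_plus_var elim!: keys_coord_sum_mult)

lemma coord_sum_nonzero: "n > 0 \<Longrightarrow> coord_sum n \<noteq> 0"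
proof
  assume "n > 0" "coord_sum n = 0"
  then have "Poly_Mapping.lookup (coord_sum n) (var 0) = 0" by simp
  moreover have "Poly_Mapping.lookup (coord_sum n) (var 0) = (\<Sum>i<n. if i = 0 then 1 else 0)"
    unfolding coord_sum_def lookup_sum coord_eq
    by (intro sum.cong) (auto simp: lookup_single when_def var_eq_iff)
  ultimately show False using \<open>n > 0\<close> by simp
qed

definition mono_eval :: "(nat \<Rightarrow> real) \<Rightarrow> (nat \<Rightarrow>\<^sub>0 nat) \<Rightarrow> real" where
  "mono_eval x \<alpha> = (\<Prod>i\<in>Poly_Mapping.keys \<alpha>. x i ^ Poly_Mapping.lookup \<alpha> i)"

lemma mono_eval_superset:
  assumes "finite A" "Poly_Mapping.keys \<alpha> \<subseteq> A"
  shows "mono_eval x \<alpha> = (\<Prod>i\<in>A. x i ^ Poly_Mapping.lookup \<alpha> i)"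
  unfolding mono_eval_def using assms
  by (intro prod.mono_neutral_left) (auto simp: in_keys_iff)

lemma mono_eval_plus: "mono_eval x (\<alpha> + \<beta>) = mono_eval x \<alpha> * mono_eval x \<beta>"
proof -
  let ?A = "Poly_Mapping.keys \<alpha> \<union> Poly_Mapping.keys \<beta>"
  have "mono_eval x (\<alpha> + \<beta>) = (\<Prod>i\<in>?A. x i ^ Poly_Mapping.lookup (\<alpha> + \<beta>) i)"
    by (rule mono_eval_superset) (auto simp: keys_plus_nat)
  also have "\<dots> = (\<Prod>i\<in>?A. x i ^ Poly_Mapping.lookup \<alpha> i) * (\<Prod>i\<in>?A. x i ^ Poly_Mapping.lookup \<beta> i)"
    by (simp add: lookup_add prod.distrib power_add)
  also have "\<dots> = mono_eval x \<alpha> * mono_eval x \<beta>"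
    by (simp add: mono_eval_superset[of ?A])
  finally show ?thesis .
qed

lemma mono_eval_var [simp]: "mono_eval x (var i) = x i"
  by (simp add: mono_eval_def lookup_var)

lemma poly_eval_superset:
  assumes "finite A" "Poly_Mapping.keys p \<subseteq> A"
  shows "poly_eval p x = (\<Sum>\<alpha>\<in>A. Poly_Mapping.lookup p \<alpha> * mono_eval x \<alpha>)"
  unfolding poly_eval_def mono_eval_def using assms
  by (intro sum.mono_neutral_left) (auto simp: in_keys_iff)

lemma poly_eval_add: "poly_eval (p + q) x = poly_eval p x + poly_eval q x"
proof -
  let ?A = "Poly_Mapping.keys p \<union> Poly_Mapping.keys q"
  have "Poly_Mapping.keys (p + q) \<subseteq> ?A" by (rule keys_add)
  then show ?thesis
    by (simp add: poly_eval_superset[of ?A] lookup_add algebra_simps sum.distrib)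
qed

lemma poly_eval_diff: "poly_eval (p - q) x = poly_eval p x - poly_eval q x"
  using poly_eval_add[of "p - q" q x] by simp

lemma poly_eval_zero [simp]: "poly_eval 0 x = 0"
  by (simp add: poly_eval_def)

lemma poly_eval_sum: "poly_eval (\<Sum>i\<in>A. f i) x = (\<Sum>i\<in>A. poly_eval (f i) x)"
  by (induction A rule: infinite_finite_induct) (auto simp: poly_eval_add)

lemma poly_eval_one [simp]: "poly_eval 1 x = 1"
  by (simp add: poly_eval_def)

lemma poly_eval_coord_mult: "poly_eval (coord i * g) x = x i * poly_eval g x"
proof -
  have keys: "Poly_Mapping.keys (coord i * g) \<subseteq> (\<lambda>\<alpha>. \<alpha> + var i) ` Poly_Mapping.keys g"
  proof
    fix \<beta> assume "\<beta> \<in> Poly_Mapping.keys (coord i * g)"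
    then have "Poly_Mapping.lookup \<beta> i > 0" "\<beta> - var i \<in> Poly_Mapping.keys g"
      by (auto simp: in_keys_iff lookup_coord_mult split: if_splits)
    then show "\<beta> \<in> (\<lambda>\<alpha>. \<alpha> + var i) ` Poly_Mapping.keys g"
      by (metis image_eqI minus_var_plus)
  qed
  have "poly_eval (coord i * g) x =
      (\<Sum>\<beta>\<in>(\<lambda>\<alpha>. \<alpha> + var i) ` Poly_Mapping.keys g. Poly_Mapping.lookup (coord i * g) \<beta> * mono_eval x \<beta>)"
    by (rule poly_eval_superset[OF _ keys]) simp
  also have "\<dots> = (\<Sum>\<alpha>\<in>Poly_Mapping.keys g. Poly_Mapping.lookup g \<alpha> * (mono_eval x \<alpha> * x i))"
    by (subst sum.reindex) (auto simp: inj_on_def lookup_coord_mult_plus mono_eval_plus)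
  also have "\<dots> = x i * poly_eval g x"
    by (simp add: poly_eval_superset[OF _ order_refl] sum_distrib_left mult_ac)
  finally show ?thesis .
qed

lemma poly_eval_coord_sum_mult: "poly_eval (coord_sum n * g) x = (\<Sum>i<n. x i) * poly_eval g x"
  unfolding coord_sum_def
  by (simp add: sum_distrib_right poly_eval_sum poly_eval_coord_mult)

lemma digits_inj:
  fixes a b :: "nat \<Rightarrow> nat"
  assumes "\<And>h. h < n \<Longrightarrow> a h < B" "\<And>h. h < n \<Longrightarrow> b h < B"
    and "(\<Sum>h<n. B ^ h * a h) = (\<Sum>h<n. B ^ h * b h)" "h < n"
  shows "a h = b h"
  using assms
proof (induction n arbitrary: h)
  case 0
  then show ?case by simp
next
  case (Suc n)
  have less: "(\<Sum>h<m. B ^ h * c h) < B ^ m" if "\<And>h. h < m \<Longrightarrow> c h < B" for m and c :: "nat \<Rightarrow> nat"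
    using that
  proof (induction m)
    case (Suc m)
    then have "(\<Sum>h<m. B ^ h * c h) < B ^ m" "c m + 1 \<le> B" by (auto simp: Suc_le_eq)
    moreover from this have "B ^ m * (c m + 1) \<le> B ^ m * B" by (intro mult_le_mono) auto
    ultimately show ?case by (simp add: algebra_simps)
  qed simp
  let ?a = "\<Sum>h<n. B ^ h * a h" and ?b = "\<Sum>h<n. B ^ h * b h"
  have la: "?a < B ^ n" and lb: "?b < B ^ n" using less Suc.prems by auto
  have eq: "?a + B ^ n * a n = ?b + B ^ n * b n" using Suc.prems(3) by simp
  have ab: "?a = ?b" using arg_cong[OF eq, of "\<lambda>u. u mod B ^ n"] la lb by simp
  moreover have "B > 0" using Suc.prems(1)[of n] by simp
  ultimately have "a n = b n" using eq by auto
  moreover have "a h = b h" if "h < n"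
    using Suc.prems(1,2) ab that by (intro Suc.IH) auto
  ultimately show ?case using Suc.prems(4) by (cases "h = n") auto
qed

lemma real_polynomial_zero:
  fixes c :: "nat \<Rightarrow> real"
  assumes "\<And>t. t > 0 \<Longrightarrow> (\<Sum>i\<le>N. c i * t ^ i) = 0" and "i \<le> N"
  shows "c i = 0"
proof (rule ccontr)
  assume "c i \<noteq> 0"
  then have "finite {t. (\<Sum>i\<le>N. c i * t ^ i) = 0}"
    using \<open>i \<le> N\<close> polyfun_finite_roots by blast
  moreover have "{0<..} \<subseteq> {t. (\<Sum>i\<le>N. c i * t ^ i) = 0}" using assms(1) by auto
  ultimately show False using infinite_Ioi finite_subset by blast
qed

text \<open>
  Kronecker substitution: for \<open>x\<^sub>h = t\<^bsup>(k + 1) ^ h\<^esup>\<close> distinct monomials of degree \<open>k\<close> become distinct powers of \<open>t\<close>,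
  and a real polynomial in \<open>t\<close> that vanishes for all \<open>t > 0\<close> has no nonzero coefficient.
\<close>

lemma poly_zero_if_eval_zero:
  assumes keys: "Poly_Mapping.keys g \<subseteq> expos n k"
    and eval: "\<And>x. (\<And>i. x i > 0) \<Longrightarrow> poly_eval g x = 0"
  shows "g = 0"
proof (rule poly_mapping_eqI)
  fix \<alpha>
  define W where "W \<alpha> = (\<Sum>h<n. Suc k ^ h * Poly_Mapping.lookup \<alpha> h)" for \<alpha>
  have inj: "inj_on W (Poly_Mapping.keys g)"
  proof (rule inj_onI)
    fix \<alpha> \<beta> assume *: "\<alpha> \<in> Poly_Mapping.keys g" "\<beta> \<in> Poly_Mapping.keys g" "W \<alpha> = W \<beta>"
    then have ab: "\<alpha> \<in> expos n k" "\<beta> \<in> expos n k" using keys by auto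
    have "Poly_Mapping.lookup \<alpha> h = Poly_Mapping.lookup \<beta> h" if "h < n" for h
      by (rule digits_inj[of n _ "Suc k"])
        (use ab expos_lookup_le *(3) that in \<open>auto simp: W_def less_Suc_eq_le\<close>)
    then show "\<alpha> = \<beta>" using expos_lookup_outside ab by (metis poly_mapping_eqI)
  qed
  define N where "N = Max (insert 0 (W ` Poly_Mapping.keys g))"
  define c where "c i = (\<Sum>\<alpha> | \<alpha> \<in> Poly_Mapping.keys g \<and> W \<alpha> = i. Poly_Mapping.lookup g \<alpha>)" for i
  have WN: "W \<alpha> \<le> N" if "\<alpha> \<in> Poly_Mapping.keys g" for \<alpha>
    unfolding N_def using that by (intro Max_ge) auto
  show "Poly_Mapping.lookup g \<alpha> = Poly_Mapping.lookup 0 \<alpha>"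
  proof (cases "\<alpha> \<in> Poly_Mapping.keys g")
    case True
    have "(\<Sum>i\<le>N. c i * t ^ i) = 0" if "t > 0" for t
    proof -
      have me: "mono_eval (\<lambda>h. t ^ (Suc k ^ h)) \<alpha> = t ^ W \<alpha>" if "\<alpha> \<in> Poly_Mapping.keys g" for \<alpha>
        using that keys
        by (subst mono_eval_superset[of "{..<n}"])
          (auto simp: expos_def W_def power_sum power_mult)
      have "0 = poly_eval g (\<lambda>h. t ^ (Suc k ^ h))" using that eval by simp
      also have "\<dots> = (\<Sum>\<alpha>\<in>Poly_Mapping.keys g. Poly_Mapping.lookup g \<alpha> * t ^ W \<alpha>)"
        unfolding poly_eval_superset[OF finite_keys order_refl] using me by simp
      also have "\<dots> = (\<Sum>i\<le>N. \<Sum>\<alpha> | \<alpha> \<in> Poly_Mapping.keys g \<and> W \<alpha> = i. Poly_Mapping.lookup g \<alpha> * t ^ W \<alpha>)"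
        by (subst sum.group) (use WN in auto)
      also have "\<dots> = (\<Sum>i\<le>N. c i * t ^ i)"
        unfolding c_def sum_distrib_right by (intro sum.cong) auto
      finally show ?thesis by simp
    qed
    then have "c (W \<alpha>) = 0" using real_polynomial_zero WN[OF True] by blast
    moreover have "{\<beta>. \<beta> \<in> Poly_Mapping.keys g \<and> W \<beta> = W \<alpha>} = {\<alpha>}"
      using inj True by (auto dest: inj_onD)
    ultimately show ?thesis by (simp add: c_def)
  qed (simp add: in_keys_iff)
qed

section \<open>Edges of the Newton polytope\<close>

text \<open>
  The powers of a base \<open>B\<close> larger than all exponents form a generic weight: it determines the exponents of
  the variables other than \<open>x\<^sub>i, x\<^sub>j\<close>. So the exponents of \<open>g\<close> with the smallest weight lie on a line in the
  direction \<open>e\<^sub>i - e\<^sub>j\<close>; the part of \<open>g\<close> on it is called the \<open>(i, j)\<close>-edge below.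
\<close>

definition off_weight :: "nat \<Rightarrow> nat \<Rightarrow> nat \<Rightarrow> nat \<Rightarrow> (nat \<Rightarrow>\<^sub>0 nat) \<Rightarrow> nat" where
  "off_weight n B i j \<alpha> = (\<Sum>h\<in>{..<n} - {i, j}. B ^ h * Poly_Mapping.lookup \<alpha> h)"

text \<open>
  A linear functional that compares weights first, preferring small ones, and then exponents of \<open>x\<^sub>i\<close>. It
  is injective on the exponents that occur, and its maximum over \<open>g\<close> is the end of the \<open>(i, j)\<close>-edge in the
  direction of \<open>x\<^sub>i\<close>. Having one linear functional for this lexicographic order makes it possible to
  compare the exponents of products by adding heights.
\<close>

definition height :: "nat \<Rightarrow> nat \<Rightarrow> nat \<Rightarrow> nat \<Rightarrow> (nat \<Rightarrow>\<^sub>0 nat) \<Rightarrow> int" where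
  "height n B i j \<alpha> = int (Poly_Mapping.lookup \<alpha> i) - int B * int (off_weight n B i j \<alpha>)"

text \<open>
  The end of the \<open>(i, j)\<close>-edge of \<open>g\<close> towards \<open>x\<^sub>i\<close>; the other end is \<open>top_expo n B j i g\<close>.
\<close>

definition top_expo :: "nat \<Rightarrow> nat \<Rightarrow> nat \<Rightarrow> nat \<Rightarrow> rpoly \<Rightarrow> (nat \<Rightarrow>\<^sub>0 nat)" where
  "top_expo n B i j g = (SOME \<alpha>. \<alpha> \<in> Poly_Mapping.keys g \<and>
     (\<forall>\<beta>\<in>Poly_Mapping.keys g. height n B i j \<beta> \<le> height n B i j \<alpha>))"

lemma off_weight_commute: "off_weight n B i j = off_weight n B j i"
  by (simp add: off_weight_def insert_commute fun_eq_iff)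

lemma off_weight_plus: "off_weight n B i j (\<alpha> + \<beta>) = off_weight n B i j \<alpha> + off_weight n B i j \<beta>"
  by (simp add: off_weight_def lookup_add algebra_simps sum.distrib)

lemma off_weight_var: "off_weight n B i j (var h) = (if h < n \<and> h \<noteq> i \<and> h \<noteq> j then B ^ h else 0)"
proof -
  have "off_weight n B i j (var h) = (\<Sum>l\<in>{..<n} - {i, j}. if l = h then B ^ l else 0)"
    unfolding off_weight_def by (intro sum.cong) (auto simp: lookup_var)
  then show ?thesis by auto
qed

lemma height_plus: "height n B i j (\<alpha> + \<beta>) = height n B i j \<alpha> + height n B i j \<beta>"
  by (simp add: height_def off_weight_plus lookup_add algebra_simps)

lemma height_var_self [simp]: "height n B i j (var i) = 1"
  by (simp add: height_def off_weight_var lookup_var)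

lemma height_var_less: "h \<noteq> i \<Longrightarrow> height n B i j (var h) < 1"
proof -
  assume "h \<noteq> i"
  then have "height n B i j (var h) = - (int B * int (off_weight n B i j (var h)))" by (simp add: height_def lookup_var)
  moreover have "int B * int (off_weight n B i j (var h)) \<ge> 0" by simp
  ultimately show ?thesis by linarith
qed

lemma height_var_le: "height n B i j (var h) \<le> 1"
  by (cases "h = i") (auto intro: less_imp_le height_var_less)

lemma off_weight_eq_lookup:
  assumes "\<alpha> \<in> expos n k" "\<beta> \<in> expos n k" "k < B" "off_weight n B i j \<alpha> = off_weight n B i j \<beta>" "h \<noteq> i" "h \<noteq> j"
  shows "Poly_Mapping.lookup \<alpha> h = Poly_Mapping.lookup \<beta> h"
proof (cases "h < n")
  case False
  then show ?thesis using assms expos_lookup_outside by simp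
next
  case True
  define c where "c \<gamma> l = (if l = i \<or> l = j then 0 else Poly_Mapping.lookup \<gamma> l)" for \<gamma> :: "nat \<Rightarrow>\<^sub>0 nat" and l
  have w: "off_weight n B i j \<gamma> = (\<Sum>l<n. B ^ l * c \<gamma> l)" for \<gamma>
    unfolding off_weight_def c_def by (rule sum.mono_neutral_cong_left) auto
  have b: "c \<gamma> l < B" if "\<gamma> \<in> expos n k" for \<gamma> l
    using expos_lookup_le[OF that, of l] \<open>k < B\<close> by (auto simp: c_def)
  have "c \<alpha> h = c \<beta> h"
    by (rule digits_inj[of n _ B]) (use assms True b w in auto)
  then show ?thesis using assms by (simp add: c_def)
qed

lemma expos_line_eqI:
  assumes "\<alpha> \<in> expos n k" "\<beta> \<in> expos n k" "k < B" "off_weight n B i j \<alpha> = off_weight n B i j \<beta>"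
    and "Poly_Mapping.lookup \<alpha> i = Poly_Mapping.lookup \<beta> i" "j < n"
  shows "\<alpha> = \<beta>"
  using assms off_weight_eq_lookup[OF assms(1-4)] by (intro expos_eqI[of \<alpha> n k \<beta> j]) metis+

lemma height_less_if_off_weight_less:
  assumes "\<beta> \<in> expos n k" "k < B" "off_weight n B i j \<alpha> < off_weight n B i j \<beta>"
  shows "height n B i j \<beta> < height n B i j \<alpha>"
proof -
  have "int (Poly_Mapping.lookup \<beta> i) < int B"
    using expos_lookup_le[OF assms(1), of i] assms(2) by simp
  moreover have "int B * (int (off_weight n B i j \<alpha>) + 1) \<le> int B * int (off_weight n B i j \<beta>)"
    using assms(3) by (intro mult_left_mono) auto
  ultimately show ?thesis unfolding height_def by (simp add: algebra_simps)
qed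

lemma off_weight_le_if_height_le:
  assumes "\<alpha> \<in> expos n k" "k < B" "height n B i j \<beta> \<le> height n B i j \<alpha>"
  shows "off_weight n B i j \<alpha> \<le> off_weight n B i j \<beta>"
  using height_less_if_off_weight_less[OF assms(1,2), of i j \<beta>] assms(3) by (meson not_le)

lemma height_inj:
  assumes "\<alpha> \<in> expos n k" "\<beta> \<in> expos n k" "k < B" "height n B i j \<alpha> = height n B i j \<beta>" "j < n"
  shows "\<alpha> = \<beta>"
proof -
  have w: "off_weight n B i j \<alpha> = off_weight n B i j \<beta>"
    using off_weight_le_if_height_le[OF assms(1,3), of i j \<beta>] off_weight_le_if_height_le[OF assms(2,3), of i j \<alpha>] assms(4) by simp
  then show ?thesis
    using assms by (intro expos_line_eqI[of \<alpha> n k \<beta> B i j]) (auto simp: height_def)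
qed

lemma top_expo_props:
  assumes "g \<noteq> 0"
  shows top_expo_in: "top_expo n B i j g \<in> Poly_Mapping.keys g"
    and top_expo_ge: "\<beta> \<in> Poly_Mapping.keys g \<Longrightarrow> height n B i j \<beta> \<le> height n B i j (top_expo n B i j g)"
proof -
  let ?H = "height n B i j ` Poly_Mapping.keys g"
  have "Max ?H \<in> ?H" using assms by (intro Max_in) auto
  then obtain \<alpha> where "\<alpha> \<in> Poly_Mapping.keys g" "height n B i j \<alpha> = Max ?H" by auto
  then have "\<alpha> \<in> Poly_Mapping.keys g \<and> (\<forall>\<beta>\<in>Poly_Mapping.keys g. height n B i j \<beta> \<le> height n B i j \<alpha>)"
    by auto
  note * = someI[of "\<lambda>\<alpha>. \<alpha> \<in> Poly_Mapping.keys g \<and> (\<forall>\<beta>\<in>Poly_Mapping.keys g. height n B i j \<beta> \<le> height n B i j \<alpha>)", OF this]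
  show "top_expo n B i j g \<in> Poly_Mapping.keys g"
    "\<beta> \<in> Poly_Mapping.keys g \<Longrightarrow> height n B i j \<beta> \<le> height n B i j (top_expo n B i j g)"
    using * unfolding top_expo_def by blast+
qed

text \<open>
  The point with \<open>i\<close>-th coordinate \<open>x\<close> on the line through \<open>A\<close> in the direction \<open>e\<^sub>i - e\<^sub>j\<close>. It is an exponent
  vector of the right degree only while \<open>x\<close> is at most the sum of the two coordinates of \<open>A\<close>; beyond that
  bound the coefficient sequence \<open>line_coeffs\<close> is continued by zero.
\<close>

definition line_point :: "nat \<Rightarrow> nat \<Rightarrow> (nat \<Rightarrow>\<^sub>0 nat) \<Rightarrow> nat \<Rightarrow> (nat \<Rightarrow>\<^sub>0 nat)" where
  "line_point i j A x = Poly_Mapping.update i x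
     (Poly_Mapping.update j (Poly_Mapping.lookup A i + Poly_Mapping.lookup A j - x) A)"

lemma lookup_line_point:
  "Poly_Mapping.lookup (line_point i j A x) h =
    (if h = i then x else if h = j then Poly_Mapping.lookup A i + Poly_Mapping.lookup A j - x
     else Poly_Mapping.lookup A h)"
  by (auto simp: line_point_def lookup_update)

lemma off_weight_line_point: "off_weight n B i j (line_point i j A x) = off_weight n B i j A"
  unfolding off_weight_def by (intro sum.cong) (auto simp: lookup_line_point)

lemma sum_lessThan_two:
  fixes f :: "nat \<Rightarrow> nat"
  assumes "i < n" "j < n" "i \<noteq> j"
  shows "(\<Sum>h<n. f h) = f i + f j + (\<Sum>h\<in>{..<n} - {i, j}. f h)"
proof -
  have "(\<Sum>h<n. f h) = f i + (\<Sum>h\<in>{..<n} - {i}. f h)"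
    using assms by (simp add: sum.remove)
  also have "(\<Sum>h\<in>{..<n} - {i}. f h) = f j + (\<Sum>h\<in>{..<n} - {i} - {j}. f h)"
    using assms by (intro sum.remove) auto
  also have "{..<n} - {i} - {j} = {..<n} - {i, j}" by auto
  finally show ?thesis by simp
qed

text \<open>
  Exponents of the same degree and the same weight lie on one line, and each of them can serve as the base
  point of its parametrization.
\<close>

lemma on_line:
  assumes "A \<in> expos n k" "\<alpha> \<in> expos n k" "k < B" "off_weight n B i j \<alpha> = off_weight n B i j A"
    and ij: "i < n" "j < n" "i \<noteq> j"
  shows "Poly_Mapping.lookup \<alpha> i + Poly_Mapping.lookup \<alpha> j = Poly_Mapping.lookup A i + Poly_Mapping.lookup A j"
    and "line_point i j \<alpha> = line_point i j A" and "line_point i j A (Poly_Mapping.lookup \<alpha> i) = \<alpha>"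
proof -
  have eq: "Poly_Mapping.lookup \<alpha> h = Poly_Mapping.lookup A h" if "h \<noteq> i" "h \<noteq> j" for h
    using off_weight_eq_lookup[OF assms(2,1,3,4)] that by simp
  have "(\<Sum>h\<in>{..<n} - {i, j}. Poly_Mapping.lookup \<alpha> h) = (\<Sum>h\<in>{..<n} - {i, j}. Poly_Mapping.lookup A h)"
    by (intro sum.cong) (auto simp: eq)
  then show s: "Poly_Mapping.lookup \<alpha> i + Poly_Mapping.lookup \<alpha> j = Poly_Mapping.lookup A i + Poly_Mapping.lookup A j"
    using expos_degree[OF assms(1)] expos_degree[OF assms(2)]
      sum_lessThan_two[OF ij, of "Poly_Mapping.lookup \<alpha>"] sum_lessThan_two[OF ij, of "Poly_Mapping.lookup A"] by linarith
  show "line_point i j \<alpha> = line_point i j A"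
    by (rule ext, rule poly_mapping_eqI) (simp add: lookup_line_point s eq)
  show "line_point i j A (Poly_Mapping.lookup \<alpha> i) = \<alpha>"
    by (rule poly_mapping_eqI) (use ij s in \<open>auto simp: lookup_line_point eq\<close>)
qed

definition line_coeffs :: "nat \<Rightarrow> nat \<Rightarrow> (nat \<Rightarrow>\<^sub>0 nat) \<Rightarrow> rpoly \<Rightarrow> nat \<Rightarrow> real" where
  "line_coeffs i j A g x = (if x \<le> Poly_Mapping.lookup A i + Poly_Mapping.lookup A j
     then Poly_Mapping.lookup g (line_point i j A x) else 0)"

lemma finite_line_coeffs: "finite {x. line_coeffs i j A g x \<noteq> 0}"
  by (rule finite_subset[of _ "{..Poly_Mapping.lookup A i + Poly_Mapping.lookup A j}"])
    (auto simp: line_coeffs_def split: if_splits)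

text \<open>
  Blocks minus one, so that monomials have value zero.
\<close>

definition edge_blocks :: "nat \<Rightarrow> nat \<Rightarrow> nat \<Rightarrow> nat \<Rightarrow> rpoly \<Rightarrow> int" where
  "edge_blocks n B i j g = (if g = 0 then 0 else alt_blocks (line_coeffs i j (top_expo n B i j g) g) - 1)"

lemma line_point_self: "i \<noteq> j \<Longrightarrow> line_point i j A (Poly_Mapping.lookup A i) = A"
  by (rule poly_mapping_eqI) (simp add: lookup_line_point)

lemma line_coeffs_self: "i \<noteq> j \<Longrightarrow> line_coeffs i j A g (Poly_Mapping.lookup A i) = Poly_Mapping.lookup g A"
  by (simp add: line_coeffs_def line_point_self)

lemma edge_blocks_nonneg: "i \<noteq> j \<Longrightarrow> edge_blocks n B i j g \<ge> 0"
proof (cases "g = 0")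
  case False
  assume "i \<noteq> j"
  then have "line_coeffs i j (top_expo n B i j g) g (Poly_Mapping.lookup (top_expo n B i j g) i) \<noteq> 0"
    using top_expo_in[OF False, of n B i j] by (simp add: line_coeffs_self in_keys_iff)
  from alt_blocks_pos[OF finite_line_coeffs this] show ?thesis using False by (simp add: edge_blocks_def)
qed (simp add: edge_blocks_def)

text \<open>
  One step \<open>g' = s g - P\<close> of the recursion with \<open>P \<ge> 0\<close>. The positivity of the ends of the edges of \<open>g'\<close> is
  an assumption; that it passes on to \<open>g\<close> is proved below, so that it can be carried backwards along the
  recursion.
\<close>

locale growth_step =
  fixes n B k :: nat and g g' :: rpoly
  assumes n4: "n \<ge> 4" and kB: "Suc k < B" and g_nz: "g \<noteq> 0"
    and g_expos: "Poly_Mapping.keys g \<subseteq> expos n k"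
    and g'_expos: "Poly_Mapping.keys g' \<subseteq> expos n (Suc k)"
    and g'_le: "\<And>\<beta>. Poly_Mapping.lookup g' \<beta> \<le> Poly_Mapping.lookup (coord_sum n * g) \<beta>"
    and tops': "\<And>i j. i < n \<Longrightarrow> j < n \<Longrightarrow> i \<noteq> j \<Longrightarrow> g' \<noteq> 0 \<Longrightarrow>
      Poly_Mapping.lookup g' (top_expo n B i j g') > 0"
begin

abbreviation "S \<equiv> coord_sum n * g"
abbreviation "P \<equiv> S - g'"
abbreviation "V i j \<equiv> top_expo n B i j g"
abbreviation "V' i j \<equiv> top_expo n B i j g'"
abbreviation "W i j \<equiv> off_weight n B i j"
abbreviation "H i j \<equiv> height n B i j"

lemma kB': "k < B" using kB by simp

lemma V_in: "V i j \<in> Poly_Mapping.keys g" by (rule top_expo_in[OF g_nz])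

lemma V_expos: "V i j \<in> expos n k" using V_in g_expos by auto

lemma end_expos: "i < n \<Longrightarrow> V i j + var i \<in> expos n (Suc k)"
  by (rule expos_plus_var[OF V_expos])

lemma H_V: "\<alpha> \<in> Poly_Mapping.keys g \<Longrightarrow> H i j \<alpha> \<le> H i j (V i j)" by (rule top_expo_ge[OF g_nz])

lemma S_expos: "Poly_Mapping.keys S \<subseteq> expos n (Suc k)"
  by (rule coord_sum_mult_expos[OF g_expos])

lemma H_S: "\<beta> \<in> Poly_Mapping.keys S \<Longrightarrow> H i j \<beta> \<le> H i j (V i j) + 1"
  by (erule keys_coord_sum_mult) (use H_V height_var_le in \<open>auto simp: height_plus intro!: add_mono\<close>)

text \<open>
  Heights add and \<open>x\<^sub>i\<close> is the only variable of the largest height, so nothing can cancel at the exponent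
  where the largest heights of \<open>s\<close> and of \<open>g\<close> are added.
\<close>

lemma S_end:
  assumes "i < n" "j < n"
  shows "Poly_Mapping.lookup S (V i j + var i) = Poly_Mapping.lookup g (V i j)"
proof -
  let ?\<beta> = "V i j + var i"
  let ?f = "\<lambda>h. if Poly_Mapping.lookup ?\<beta> h > 0 then Poly_Mapping.lookup g (?\<beta> - var h) else 0"
  have "?f h = 0" if "h \<noteq> i" for h
  proof (cases "Poly_Mapping.lookup ?\<beta> h > 0 \<and> ?\<beta> - var h \<in> Poly_Mapping.keys g")
    case True
    then have "H i j (?\<beta> - var h) \<le> H i j (V i j)" using H_V by blast
    moreover have "H i j (?\<beta> - var h) + H i j (var h) = H i j (V i j) + H i j (var i)"
      using True minus_var_plus[of ?\<beta> h] by (metis height_plus)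
    ultimately show ?thesis using height_var_less[OF that, of n B j] by simp
  qed (auto simp: in_keys_iff)
  then have "(\<Sum>h<n. ?f h) = (\<Sum>h<n. if h = i then ?f i else 0)"
    by (intro sum.cong) auto
  then show ?thesis unfolding lookup_coord_sum_mult using assms by (simp add: lookup_add lookup_var)
qed

lemma V'_in: "g' \<noteq> 0 \<Longrightarrow> V' i j \<in> Poly_Mapping.keys g'" by (rule top_expo_in)

lemma V'_expos: "g' \<noteq> 0 \<Longrightarrow> V' i j \<in> expos n (Suc k)" using V'_in g'_expos by auto

text \<open>
  At an end of an edge \<open>g'\<close> is positive, hence so is \<open>s g\<close>. So the Newton polytope of \<open>g'\<close> does not exceed
  that of \<open>s g\<close> in the direction of the functional.
\<close>

lemma H_V':
  assumes "i < n" "j < n" "i \<noteq> j" "g' \<noteq> 0"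
  shows "H i j (V' i j) \<le> H i j (V i j) + 1"
proof -
  have "Poly_Mapping.lookup S (V' i j) > 0" using tops'[OF assms] g'_le by (metis less_le_trans)
  then show ?thesis by (intro H_S) (simp add: in_keys_iff)
qed

lemma H_g':
  assumes "i < n" "j < n" "i \<noteq> j" "\<beta> \<in> Poly_Mapping.keys g'"
  shows "H i j \<beta> \<le> H i j (V i j) + 1"
proof -
  have "g' \<noteq> 0" using assms(4) by auto
  then show ?thesis using top_expo_ge[of g' \<beta>] assms H_V' order_trans by blast
qed

lemma end_survives:
  assumes "i < n" "j < n" "i \<noteq> j" "V i j + var i \<in> Poly_Mapping.keys g'"
  shows "V' i j = V i j + var i"
proof -
  have nz: "g' \<noteq> 0" using assms(4) by auto
  have "H i j (V i j + var i) \<le> H i j (V' i j)" using top_expo_ge[OF nz assms(4)] .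
  with H_V'[OF assms(1-3) nz] have "H i j (V' i j) = H i j (V i j + var i)" by (simp add: height_plus)
  then show ?thesis using height_inj V'_expos[OF nz] end_expos assms kB by blast
qed

lemma g'_end_nonneg:
  assumes "i < n" "j < n" "i \<noteq> j"
  shows "Poly_Mapping.lookup g' (V i j + var i) \<ge> 0"
proof (cases "V i j + var i \<in> Poly_Mapping.keys g'")
  case True
  then have "g' \<noteq> 0" by auto
  then show ?thesis using end_survives[OF assms True] tops'[OF assms] by (metis less_imp_le)
qed (simp add: in_keys_iff)

text \<open>
  The coefficient of \<open>s g\<close> at the end of its edge is that of \<open>g\<close>, and it is at least that of \<open>g'\<close>. The
  latter is zero, or it belongs to an end of an edge of \<open>g'\<close> and is positive.
\<close>

lemma top_pos:
  assumes "i < n" "j < n" "i \<noteq> j"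
  shows "Poly_Mapping.lookup g (V i j) > 0"
proof -
  have "Poly_Mapping.lookup g (V i j) \<ge> 0"
    using g'_end_nonneg[OF assms] g'_le[of "V i j + var i"] S_end[OF assms(1,2)] by simp
  moreover have "Poly_Mapping.lookup g (V i j) \<noteq> 0" using V_in by (simp add: in_keys_iff)
  ultimately show ?thesis by simp
qed

lemma W_V: "\<alpha> \<in> Poly_Mapping.keys g \<Longrightarrow> W i j (V i j) \<le> W i j \<alpha>"
  using off_weight_le_if_height_le[OF V_expos kB'] H_V by blast

lemma W_V_commute: "W i j (V j i) = W i j (V i j)"
  using W_V[OF V_in, of i j j i] W_V[OF V_in, of j i i j] by (metis off_weight_commute order_antisym)

lemma W_end: "W i j (V i j + var i) = W i j (V i j)"
  by (simp add: off_weight_plus off_weight_var)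

lemma W_end': "W i j (V j i + var j) = W i j (V i j)"
  by (simp add: off_weight_plus off_weight_var W_V_commute)

lemma W_S: "\<beta> \<in> Poly_Mapping.keys S \<Longrightarrow> W i j (V i j) \<le> W i j \<beta>"
  by (erule keys_coord_sum_mult) (use W_V in \<open>auto simp: off_weight_plus intro: trans_le_add1\<close>)

lemma W_g':
  assumes "i < n" "j < n" "i \<noteq> j" "\<beta> \<in> Poly_Mapping.keys g'"
  shows "W i j (V i j) \<le> W i j \<beta>"
proof -
  have "H i j \<beta> \<le> H i j (V i j + var i)" using H_g'[OF assms] by (simp add: height_plus)
  then show ?thesis using off_weight_le_if_height_le[OF end_expos[OF assms(1)] kB] W_end by metis
qed

lemma line_le:
  assumes "\<alpha> \<in> Poly_Mapping.keys g" "W i j \<alpha> = W i j (V i j)"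
  shows "Poly_Mapping.lookup \<alpha> i \<le> Poly_Mapping.lookup (V i j) i"
  using H_V[OF assms(1), of i j] assms(2) by (simp add: height_def)

text \<open>
  On an edge of smallest weight, only the variables \<open>x\<^sub>i, x\<^sub>j\<close> of weight zero contribute to the product with
  \<open>s\<close>.
\<close>

lemma line_coeffs_S:
  assumes ij: "i < n" "j < n" "i \<noteq> j"
  shows "line_coeffs i j (V i j + var i) S = add_shift (line_coeffs i j (V i j) g)"
proof
  fix x
  let ?A = "V i j" let ?A1 = "?A + var i"
  define D where "D = Poly_Mapping.lookup ?A i + Poly_Mapping.lookup ?A j"
  have D1: "Poly_Mapping.lookup ?A1 i + Poly_Mapping.lookup ?A1 j = Suc D"
    using ij by (simp add: D_def lookup_add lookup_var)
  show "line_coeffs i j ?A1 S x = add_shift (line_coeffs i j ?A g) x"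
  proof (cases "x \<le> Suc D")
    case False
    then have "\<not> x \<le> D" "\<not> x - 1 \<le> D" "x \<noteq> 0" by auto
    then show ?thesis using D1 False by (simp add: line_coeffs_def add_shift_def D_def[symmetric])
  next
    case True
    let ?\<beta> = "line_point i j ?A1 x"
    let ?f = "\<lambda>h. if Poly_Mapping.lookup ?\<beta> h > 0 then Poly_Mapping.lookup g (?\<beta> - var h) else 0"
    have z: "?f h = 0" if "h < n" "h \<noteq> i" "h \<noteq> j" for h
    proof (cases "Poly_Mapping.lookup ?\<beta> h > 0 \<and> ?\<beta> - var h \<in> Poly_Mapping.keys g")
      case True
      then have "W i j ?A \<le> W i j (?\<beta> - var h)" using W_V by blast
      moreover have "W i j (?\<beta> - var h) + W i j (var h) = W i j ?\<beta>"
        using True minus_var_plus[of ?\<beta> h] by (metis off_weight_plus)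
      moreover have "W i j (var h) > 0" using that kB by (simp add: off_weight_var)
      ultimately show ?thesis by (simp add: off_weight_line_point W_end)
    qed (auto simp: in_keys_iff)
    have bi: "?\<beta> - var i = line_point i j ?A (x - 1)" if "x > 0"
      by (rule poly_mapping_eqI)
        (use that True D1 ij in \<open>auto simp: lookup_line_point lookup_minus lookup_var lookup_add D_def\<close>)
    have bj: "?\<beta> - var j = line_point i j ?A x"
      by (rule poly_mapping_eqI)
        (use True D1 ij in \<open>auto simp: lookup_line_point lookup_minus lookup_var lookup_add D_def\<close>)
    have "Poly_Mapping.lookup S ?\<beta> = (\<Sum>h\<in>{i, j}. ?f h)"
      unfolding lookup_coord_sum_mult by (rule sum.mono_neutral_right) (use ij z in auto)
    also have "\<dots> = ?f i + ?f j" using ij by simp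
    also have "?f i = (if x = 0 then 0 else Poly_Mapping.lookup g (line_point i j ?A (x - 1)))"
      using bi by (simp add: lookup_line_point)
    also have "?f j = (if x \<le> D then Poly_Mapping.lookup g (line_point i j ?A x) else 0)"
      using bj ij True D1 by (simp add: lookup_line_point)
    finally show ?thesis using True D1 by (auto simp: line_coeffs_def add_shift_def D_def[symmetric])
  qed
qed

text \<open>
  What \<open>P\<close> can do to the \<open>(i, j)\<close>-edge of \<open>s g\<close>: remove its end towards \<open>x\<^sub>i\<close>, or remove all of it, so that
  the \<open>(i, j)\<close>-edge of \<open>g'\<close> is on a line of larger weight. Lowering the coefficient of the end to another
  positive value does not count as killing it.
\<close>

definition killed :: "nat \<Rightarrow> nat \<Rightarrow> bool" where
  "killed i j \<longleftrightarrow> V i j + var i \<notin> Poly_Mapping.keys g'"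

definition wiped :: "nat \<Rightarrow> nat \<Rightarrow> bool" where
  "wiped i j \<longleftrightarrow> g' = 0 \<or> W i j (V' i j) \<noteq> W i j (V i j)"

text \<open>
  The terms of \<open>P\<close> inside the \<open>(i, j)\<close>-edge of \<open>s g\<close>; by \<open>inner_terms_ends\<close> below they really are strictly
  between its two ends.
\<close>

definition inner_terms :: "nat \<Rightarrow> nat \<Rightarrow> (nat \<Rightarrow>\<^sub>0 nat) set" where
  "inner_terms i j = {\<beta> \<in> Poly_Mapping.keys P. W i j \<beta> = W i j (V i j) \<and>
     \<beta> \<noteq> V i j + var i \<and> \<beta> \<noteq> V j i + var j}"

lemma finite_inner_terms [simp]: "finite (inner_terms i j)"
  by (rule finite_subset[OF _ finite_keys[of P]]) (auto simp: inner_terms_def)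

lemma inner_terms_commute: "inner_terms i j = inner_terms j i"
  unfolding inner_terms_def using W_V_commute[of i j] by (auto simp: off_weight_commute[of n B j i])

lemma P_expos: "Poly_Mapping.keys P \<subseteq> expos n (Suc k)"
proof
  fix \<beta> assume "\<beta> \<in> Poly_Mapping.keys P"
  then have "\<beta> \<in> Poly_Mapping.keys S \<or> \<beta> \<in> Poly_Mapping.keys g'" by (auto simp: in_keys_iff lookup_minus)
  then show "\<beta> \<in> expos n (Suc k)" using S_expos g'_expos by auto
qed

lemma wiped_above:
  assumes "i < n" "j < n" "i \<noteq> j" "wiped i j" "\<beta> \<in> Poly_Mapping.keys g'"
  shows "W i j (V i j) < W i j \<beta>"
proof -
  have nz: "g' \<noteq> 0" using assms(5) by auto
  have "W i j (V' i j) \<le> W i j \<beta>"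
    using off_weight_le_if_height_le[OF V'_expos[OF nz] kB] top_expo_ge[OF nz assms(5)] by blast
  moreover have "W i j (V i j) \<le> W i j (V' i j)" using W_g'[OF assms(1-3) V'_in[OF nz]] .
  ultimately show ?thesis using assms(4) nz by (auto simp: wiped_def)
qed

lemma wiped_killed:
  assumes "i < n" "j < n" "i \<noteq> j" "wiped i j"
  shows "killed i j" "killed j i"
  using wiped_above[OF assms] W_end[of i j] W_end'[of i j] by (force simp: killed_def)+

lemma wiped_commute:
  assumes "i < n" "j < n" "i \<noteq> j"
  shows "wiped i j \<longleftrightarrow> wiped j i"
proof -
  have "wiped j i" if "wiped i j" "i < n" "j < n" "i \<noteq> j" for i j
    using that wiped_above[OF that(2,3,4,1) V'_in[of j i]] W_V_commute[of i j]
    by (auto simp: wiped_def off_weight_commute[of n B j i])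
  then show ?thesis using assms by metis
qed

text \<open>
  The account of a single edge. It gains a block in the product with \<open>s\<close>, and loses at most two for every
  inner term of \<open>P\<close> and one for every killed end. If the edge is wiped out, all its terms in \<open>s g\<close> are
  terms of \<open>P\<close> and hence positive, so that each of them is a block of its own. Then the terms of \<open>P\<close> on the
  edge pay for more than what is lost.
\<close>

lemma pair_bound:
  assumes ij: "i < n" "j < n" "i \<noteq> j"
  shows "edge_blocks n B i j g + 1 + of_bool (wiped i j) * (int (card (inner_terms i j)) + 1)
    \<le> edge_blocks n B i j g' + 2 * int (card (inner_terms i j)) + of_bool (killed i j) + of_bool (killed j i)"
proof -
  let ?A = "V i j" let ?A1 = "V i j + var i"
  let ?U = "line_coeffs i j ?A1 S" and ?T' = "line_coeffs i j ?A1 g'" and ?T = "line_coeffs i j ?A g"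
  define hi where "hi = Poly_Mapping.lookup ?A1 i"
  define lo where "lo = Poly_Mapping.lookup (V j i + var j) i"
  define D where "D = Poly_Mapping.lookup ?A1 i + Poly_Mapping.lookup ?A1 j"
  have "Poly_Mapping.lookup (V j i) i \<le> Poly_Mapping.lookup (V i j) i"
    by (rule line_le[OF V_in W_V_commute])
  then have lohi: "lo \<noteq> hi" using ij by (simp add: lo_def hi_def lookup_add lookup_var)
  have line_point_hi: "line_point i j ?A1 hi = ?A1" using ij by (simp add: hi_def line_point_self)
  have lo_line: "W i j (V j i + var j) = W i j ?A1" by (simp add: W_end W_end')
  have line_point_lo: "line_point i j ?A1 lo = V j i + var j"
    unfolding lo_def by (rule on_line(3)[OF end_expos end_expos kB lo_line]) (use ij in auto)
  have lo_D: "lo \<le> D" and hi_D: "hi \<le> D"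
    using on_line(1)[OF end_expos end_expos kB lo_line ij] ij unfolding lo_def hi_def D_def by auto
  have U_hi: "?U hi = Poly_Mapping.lookup g (V i j)"
    using hi_D line_point_hi S_end[OF ij(1,2)] by (simp add: line_coeffs_def D_def)
  have U_lo: "?U lo = Poly_Mapping.lookup g (V j i)"
    using lo_D line_point_lo S_end[OF ij(2,1)] by (simp add: line_coeffs_def D_def)
  have T_hi: "?T' hi = Poly_Mapping.lookup g' (V i j + var i)"
    using hi_D line_point_hi by (simp add: line_coeffs_def D_def)
  have T_lo: "?T' lo = Poly_Mapping.lookup g' (V j i + var j)"
    using lo_D line_point_lo by (simp add: line_coeffs_def D_def)
  have "?T (Poly_Mapping.lookup ?A i) \<noteq> 0" using ij V_in by (simp add: line_coeffs_self in_keys_iff)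
  then have grow: "alt_blocks ?T + 1 \<le> alt_blocks ?U"
    using alt_blocks_add_shift[OF finite_line_coeffs] line_coeffs_S[OF ij] by metis
  define X where "X = {x. x \<le> D \<and> ?U x \<noteq> ?T' x} - {lo, hi}"
  have finX: "finite X" by (rule finite_subset[of _ "{..D}"]) (auto simp: X_def)
  have X_card: "card X \<le> card (inner_terms i j)"
  proof (rule card_inj_on_le[of "line_point i j ?A1"])
    show "inj_on (line_point i j ?A1) X"
      by (rule inj_onI) (metis lookup_line_point)
    show "line_point i j ?A1 ` X \<subseteq> inner_terms i j"
    proof
      fix \<beta> assume "\<beta> \<in> line_point i j ?A1 ` X"
      then obtain x where x: "x \<in> X" "\<beta> = line_point i j ?A1 x" by auto
      then have "x \<le> D" "Poly_Mapping.lookup P \<beta> \<noteq> 0"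
        by (auto simp: X_def line_coeffs_def D_def lookup_minus)
      moreover have "Poly_Mapping.lookup \<beta> i = x" by (simp add: x lookup_line_point)
      then have "\<beta> \<noteq> ?A1" "\<beta> \<noteq> V j i + var j" using x by (auto simp: X_def hi_def lo_def)
      moreover have "W i j \<beta> = W i j (V i j)" by (simp add: x off_weight_line_point W_end)
      ultimately show "\<beta> \<in> inner_terms i j" by (simp add: inner_terms_def in_keys_iff)
    qed
  qed simp
  have eg: "edge_blocks n B i j g = alt_blocks ?T - 1" using g_nz by (simp add: edge_blocks_def)
  show ?thesis
  proof (cases "wiped i j")
    case False
    then have nz: "g' \<noteq> 0" and w: "W i j (V' i j) = W i j ?A1" by (auto simp: wiped_def W_end)
    note ol = on_line[OF end_expos[OF ij(1)] V'_expos[OF nz] kB w ij]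
    have "line_coeffs i j (V' i j) g' = ?T'"
      by (rule ext) (simp add: line_coeffs_def ol(1,2))
    then have eg': "edge_blocks n B i j g' = alt_blocks ?T' - 1" using nz by (simp add: edge_blocks_def)
    have "alt_blocks ?T' \<ge> alt_blocks ?U - 2 * int (card X) - of_bool (?T' lo = 0) - of_bool (?T' hi = 0)"
    proof (rule alt_blocks_change[OF finite_line_coeffs finX _ _ _ lohi])
      show "?T' x = ?U x" if "x \<notin> X" "x \<noteq> lo" "x \<noteq> hi" for x
        using that by (cases "x \<le> D") (auto simp: X_def line_coeffs_def D_def)
    qed (use U_hi U_lo T_hi T_lo top_pos[OF ij] top_pos[of j i] g'_end_nonneg[OF ij] g'_end_nonneg[of j i] ij
        in \<open>auto simp: X_def\<close>)
    moreover have "(?T' lo = 0) = killed j i" "(?T' hi = 0) = killed i j"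
      by (auto simp: T_lo T_hi killed_def in_keys_iff)
    ultimately show ?thesis using False grow X_card eg eg' by simp
  next
    case True
    have T0: "?T' x = 0" for x
    proof (cases "x \<le> D")
      case xD: True
      then have "line_point i j ?A1 x \<notin> Poly_Mapping.keys g'"
        using wiped_above[OF ij True, of "line_point i j ?A1 x"] by (auto simp: off_weight_line_point W_end)
      then show ?thesis by (simp add: line_coeffs_def in_keys_iff)
    qed (simp add: line_coeffs_def D_def)
    have "?U x \<ge> 0" for x
      using T0[of x] g'_le[of "line_point i j ?A1 x"] by (auto simp: line_coeffs_def split: if_splits)
    then have "{x. ?U x * ?U (Suc x) < 0} = {}" by (auto simp: not_less)
    then have "alt_blocks ?U = int (card {x. ?U x \<noteq> 0})" by (simp add: alt_blocks_def)
    moreover have "{x. ?U x \<noteq> 0} \<subseteq> X \<union> {lo, hi}"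
      using T0 by (auto simp: X_def line_coeffs_def D_def split: if_splits)
    then have "card {x. ?U x \<noteq> 0} \<le> card (X \<union> {lo, hi})" using finX by (intro card_mono) auto
    moreover have "card (X \<union> {lo, hi}) \<le> card X + 2"
      using card_Un_le[of X "{lo, hi}"] lohi by simp
    ultimately have "alt_blocks ?U \<le> int (card (inner_terms i j)) + 2" using X_card by linarith
    then show ?thesis using True wiped_killed[OF ij True] grow eg edge_blocks_nonneg[OF ij(3), of n B g'] by simp
  qed
qed

end

section \<open>The potential\<close>

text \<open>
  For each \<open>i\<close> there are \<open>n - 1\<close> edges \<open>(i, j)\<close>; the number of their distinct ends towards \<open>x\<^sub>i\<close> enters the
  potential because one term of \<open>P\<close> can kill several ends that coincide. Both parts are zero for the zero
  polynomial by convention, which makes the final step of the recursion obey the same bound as the others.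
\<close>

definition num_tips :: "nat \<Rightarrow> nat \<Rightarrow> nat \<Rightarrow> rpoly \<Rightarrow> nat" where
  "num_tips n B i g = (if g = 0 then 0 else card ((\<lambda>j. top_expo n B i j g) ` ({..<n} - {i})))"

definition potential :: "nat \<Rightarrow> nat \<Rightarrow> rpoly \<Rightarrow> int" where
  "potential n B g = (\<Sum>i<n. int (num_tips n B i g) + (\<Sum>j\<in>{..<n} - {i}. edge_blocks n B i j g))"

lemma off_weight_single: "off_weight n B i j (Poly_Mapping.single h x) = x * off_weight n B i j (var h)"
  unfolding off_weight_def sum_distrib_left
  by (intro sum.cong) (auto simp: lookup_single lookup_var when_def)

lemma height_single: "height n B i j (Poly_Mapping.single h x) = int x * height n B i j (var h)"
  by (auto simp: height_def off_weight_single lookup_single lookup_var when_def algebra_simps)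

text \<open>
  Moving along a line, stated without subtraction of exponents so that a linear functional can be applied to
  both sides.
\<close>

lemma line_shift:
  assumes "A \<in> expos n k" "\<beta> \<in> expos n k" "k < B" "off_weight n B i j \<beta> = off_weight n B i j A"
    and ij: "i < n" "j < n" "i \<noteq> j" and less: "Poly_Mapping.lookup \<beta> i < Poly_Mapping.lookup A i"
  obtains x where "x > 0" "\<beta> + Poly_Mapping.single i x = A + Poly_Mapping.single j x"
proof -
  define x where "x = Poly_Mapping.lookup A i - Poly_Mapping.lookup \<beta> i"
  note ol = on_line(1)[OF assms(1-4) ij]
  have eq: "Poly_Mapping.lookup \<beta> h = Poly_Mapping.lookup A h" if "h \<noteq> i" "h \<noteq> j" for h
    using off_weight_eq_lookup[OF assms(2,1,3,4)] that by simp
  have "\<beta> + Poly_Mapping.single i x = A + Poly_Mapping.single j x"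
    by (rule poly_mapping_eqI)
      (use ol less eq ij in \<open>auto simp: lookup_add lookup_single when_def x_def\<close>)
  then show thesis using that[of x] less by (simp add: x_def)
qed

lemma sum_ordered_pairs:
  fixes f :: "nat \<Rightarrow> nat \<Rightarrow> int"
  shows "(\<Sum>i<n. \<Sum>j\<in>{..<n} - {i}. f i j) = (\<Sum>i<n. \<Sum>j<i. f i j + f j i)"
proof (induction n)
  case (Suc n)
  have "(\<Sum>i<n. \<Sum>j\<in>{..<Suc n} - {i}. f i j) = (\<Sum>i<n. f i n + (\<Sum>j\<in>{..<n} - {i}. f i j))"
  proof (intro sum.cong refl)
    fix i assume "i \<in> {..<n}"
    then have "{..<Suc n} - {i} = insert n ({..<n} - {i})" by auto
    then show "(\<Sum>j\<in>{..<Suc n} - {i}. f i j) = f i n + (\<Sum>j\<in>{..<n} - {i}. f i j)" by simp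
  qed
  moreover have "{..<Suc n} - {n} = {..<n}" by auto
  ultimately show ?case using Suc by (simp add: sum.distrib)
qed simp

lemma sum_ordered_pairs_swap:
  fixes f :: "nat \<Rightarrow> nat \<Rightarrow> int"
  shows "(\<Sum>i<n. \<Sum>j\<in>{..<n} - {i}. f j i) = (\<Sum>i<n. \<Sum>j\<in>{..<n} - {i}. f i j)"
  unfolding sum_ordered_pairs by (simp add: add.commute)

context growth_step
begin

abbreviation "N i \<equiv> {..<n} - {i}"

definition "killed_ends i = (\<lambda>j. V i j + var i) ` {j \<in> N i. killed i j}"

definition "num_killed i = card {j \<in> N i. killed i j}"

definition "num_wiped i = card {j \<in> N i. wiped i j}"

text \<open>
  If the end of an edge is killed but the edge is not wiped out, the new end is a point further inside the
  same edge.
\<close>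

lemma displaced:
  assumes ij: "i < n" "j < n" "i \<noteq> j" and "killed i j" "\<not> wiped i j"
  obtains x where "x > 0" "V' i j + Poly_Mapping.single i x = V i j + var i + Poly_Mapping.single j x"
proof -
  have nz: "g' \<noteq> 0" and w: "W i j (V' i j) = W i j (V i j + var i)"
    using assms(5) by (auto simp: wiped_def W_end)
  have ne: "V' i j \<noteq> V i j + var i" using assms(4) V'_in[OF nz, of i j] by (auto simp: killed_def)
  have "H i j (V' i j) \<le> H i j (V i j + var i)" using H_V'[OF ij nz] by (simp add: height_plus)
  then have "Poly_Mapping.lookup (V' i j) i \<le> Poly_Mapping.lookup (V i j + var i) i"
    using w by (simp add: height_def)
  moreover have "Poly_Mapping.lookup (V' i j) i \<noteq> Poly_Mapping.lookup (V i j + var i) i"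
    using expos_line_eqI[OF V'_expos[OF nz] end_expos[OF ij(1)] kB w] ne ij(2) by blast
  ultimately have "Poly_Mapping.lookup (V' i j) i < Poly_Mapping.lookup (V i j + var i) i" by simp
  from line_shift[OF end_expos[OF ij(1)] V'_expos[OF nz] kB w ij this] that show thesis by blast
qed

text \<open>
  Killing an end shared by several edges separates them: the edges \<open>(i, j)\<close> and \<open>(i, l)\<close> of a polytope cannot
  meet except at their ends towards \<open>x\<^sub>i\<close>, so that the new ends of the edges that are not wiped out differ from
  each other and from the ends that survive.
\<close>

lemma num_tips_bound:
  assumes i: "i < n"
  shows "num_tips n B i g + num_killed i \<le> num_tips n B i g' + card (killed_ends i) + num_wiped i"
proof (cases "g' = 0")
  case True
  have "killed i j" "wiped i j" for j unfolding killed_def wiped_def using True by auto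
  then have "killed_ends i = (\<lambda>\<alpha>. \<alpha> + var i) ` (\<lambda>j. V i j) ` N i" "num_killed i = num_wiped i"
    by (auto simp: killed_ends_def num_killed_def num_wiped_def image_image)
  moreover have "card ((\<lambda>\<alpha>. \<alpha> + var i) ` (\<lambda>j. V i j) ` N i) = num_tips n B i g"
    using g_nz by (subst card_image) (auto simp: num_tips_def inj_on_def)
  ultimately show ?thesis by simp
next
  case False
  define SU where "SU = (\<lambda>j. V i j + var i) ` {j \<in> N i. \<not> killed i j}"
  define KU where "KU = {j \<in> N i. killed i j \<and> \<not> wiped i j}"
  have un: "killed_ends i \<union> SU = (\<lambda>\<alpha>. \<alpha> + var i) ` (\<lambda>j. V i j) ` N i"
    by (auto simp: killed_ends_def SU_def image_image)
  have "killed_ends i \<inter> SU = {}" by (auto simp: killed_ends_def SU_def killed_def)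
  then have "card (killed_ends i) + card SU = card (killed_ends i \<union> SU)"
    by (intro card_Un_disjoint[symmetric]) (simp_all add: killed_ends_def SU_def)
  also have "\<dots> = num_tips n B i g"
    unfolding un using g_nz by (subst card_image) (auto simp: num_tips_def inj_on_def)
  finally have num_tips_g: "num_tips n B i g = card (killed_ends i) + card SU" ..
  have "{j \<in> N i. killed i j} = KU \<union> {j \<in> N i. wiped i j}" "KU \<inter> {j \<in> N i. wiped i j} = {}"
    using wiped_killed(1) i by (auto simp: KU_def)
  then have nk: "num_killed i = card KU + num_wiped i"
    unfolding num_killed_def num_wiped_def by (simp add: card_Un_disjoint KU_def)
  \<comment> \<open>a point inside the edges \<open>(i, j)\<close> and \<open>(i, l)\<close> would have minimal \<open>(i, j)\<close>-weight, but moving along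
    \<open>(i, l)\<close> away from the end increases this weight\<close>
  have inj: "inj_on (V' i) KU"
  proof (rule inj_onI, rule ccontr)
    fix j l assume jl: "j \<in> KU" "l \<in> KU" "V' i j = V' i l" "j \<noteq> l"
    then have j: "j < n" "i \<noteq> j" "\<not> wiped i j" and l: "l < n" "i \<noteq> l" "killed i l" "\<not> wiped i l"
      by (auto simp: KU_def)
    obtain y where y: "y > 0" "V' i l + Poly_Mapping.single i y = V i l + var i + Poly_Mapping.single l y"
      using displaced[OF i l] .
    from arg_cong[OF y(2), of "W i j"] have "W i j (V' i l) = W i j (V i l) + y * B ^ l"
      using jl(4) l by (simp add: off_weight_plus off_weight_single off_weight_var)
    moreover have "W i j (V' i l) = W i j (V i j)" using jl(3) j(3) by (simp add: wiped_def)
    moreover have "W i j (V i j) \<le> W i j (V i l)" by (rule W_V[OF V_in])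
    ultimately show False using y(1) kB by simp
  qed
  \<comment> \<open>a surviving end maximizes its height over \<open>s g\<close>, but the height of a displaced end is smaller than
    that of the end it comes from\<close>
  have disj: "SU \<inter> V' i ` KU = {}"
  proof (rule ccontr)
    assume "SU \<inter> V' i ` KU \<noteq> {}"
    then obtain \<beta> where "\<beta> \<in> SU" "\<beta> \<in> V' i ` KU" by blast
    then obtain j l where jl: "j \<in> KU" "l < n" "l \<noteq> i" "\<not> killed i l" "V' i j = V i l + var i"
      unfolding SU_def by auto
    then have j: "j < n" "i \<noteq> j" "killed i j" "\<not> wiped i j" by (auto simp: KU_def)
    obtain x where x: "x > 0" "V' i j + Poly_Mapping.single i x = V i j + var i + Poly_Mapping.single j x"
      using displaced[OF i j] .
    from arg_cong[OF x(2), of "H i l"] have "H i l (V i l) + int x = H i l (V i j) + int x * H i l (var j)"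
      unfolding jl(5) by (simp add: height_plus height_single)
    moreover have "H i l (V i j) \<le> H i l (V i l)" by (rule H_V[OF V_in])
    moreover have "int x * H i l (var j) \<le> 0"
      using height_var_less[of j i n B l] j by (simp add: mult_le_0_iff)
    ultimately show False using x(1) by simp
  qed
  have "SU \<subseteq> V' i ` N i"
  proof
    fix \<beta> assume "\<beta> \<in> SU"
    then obtain j where j: "j \<in> N i" "\<not> killed i j" "\<beta> = V i j + var i" by (auto simp: SU_def)
    then have "V' i j = \<beta>" using end_survives[OF i, of j] by (auto simp: killed_def)
    then show "\<beta> \<in> V' i ` N i" using j(1) by blast
  qed
  moreover have "V' i ` KU \<subseteq> V' i ` N i" by (auto simp: KU_def)
  ultimately have "card (SU \<union> V' i ` KU) \<le> card (V' i ` N i)" by (intro card_mono) auto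
  moreover have "card (SU \<union> V' i ` KU) = card SU + card KU"
    using disj inj by (subst card_Un_disjoint) (auto simp: SU_def KU_def card_image)
  moreover have "card (V' i ` N i) = num_tips n B i g'" using False by (simp add: num_tips_def)
  ultimately show ?thesis using num_tips_g nk by simp
qed

lemma num_killed_le: "i < n \<Longrightarrow> num_killed i \<le> (n - 1) * card (killed_ends i)"
proof (cases "{j \<in> N i. killed i j} = {}")
  case True
  then show ?thesis unfolding num_killed_def by (simp only: card.empty)
next
  case False
  assume "i < n"
  have "num_killed i \<le> card (N i)" unfolding num_killed_def by (intro card_mono) auto
  moreover have "card (N i) = n - 1" using \<open>i < n\<close> by simp
  moreover have "card (killed_ends i) \<noteq> 0" unfolding killed_ends_def using False by simp
  then have "n - 1 \<le> (n - 1) * card (killed_ends i)" by simp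
  ultimately show ?thesis by linarith
qed

lemma end_in_S: "i < n \<Longrightarrow> j < n \<Longrightarrow> V i j + var i \<in> Poly_Mapping.keys S"
  using S_end V_in by (simp add: in_keys_iff)

text \<open>
  A point that maximizes a functional over the Minkowski sum of the Newton polytope of \<open>g\<close> and the simplex
  is the sum of the two maximal points only. So the variable by which an end arises is determined.
\<close>

lemma killed_ends_disjoint:
  assumes "i < n" "l < n" "i \<noteq> l"
  shows "killed_ends i \<inter> killed_ends l = {}"
proof (rule ccontr)
  assume "killed_ends i \<inter> killed_ends l \<noteq> {}"
  then obtain j h where "V i j + var i = V l h + var l" by (auto simp: killed_ends_def)
  from arg_cong[OF this, of "H i j"]
  have "H i j (V i j) + 1 = H i j (V l h) + H i j (var l)" by (simp add: height_plus)
  moreover have "H i j (V l h) \<le> H i j (V i j)" by (rule H_V[OF V_in])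
  moreover have "H i j (var l) < 1" using assms by (intro height_var_less) simp
  ultimately show False by simp
qed

lemma killed_ends_P:
  assumes "i < n" shows "killed_ends i \<subseteq> Poly_Mapping.keys P"
proof
  fix \<beta> assume "\<beta> \<in> killed_ends i"
  then obtain j where "j < n" "killed i j" "\<beta> = V i j + var i" by (auto simp: killed_ends_def)
  then show "\<beta> \<in> Poly_Mapping.keys P"
    using end_in_S[OF assms, of j] by (simp add: killed_def in_keys_iff lookup_minus)
qed

text \<open>
  An inner term has the same weight as the two ends and does not exceed them in height.
\<close>

lemma inner_terms_end:
  assumes ij: "i < n" "j < n" "i \<noteq> j" and \<beta>: "\<beta> \<in> inner_terms i j"
  obtains x where "x > 0" "\<beta> + Poly_Mapping.single i x = V i j + var i + Poly_Mapping.single j x"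
proof -
  have P: "\<beta> \<in> Poly_Mapping.keys P" and w: "W i j \<beta> = W i j (V i j + var i)"
    and ne: "\<beta> \<noteq> V i j + var i" using \<beta> by (auto simp: inner_terms_def W_end)
  then have b: "\<beta> \<in> expos n (Suc k)" using P_expos by auto
  have "\<beta> \<in> Poly_Mapping.keys S \<or> \<beta> \<in> Poly_Mapping.keys g'" using P by (auto simp: in_keys_iff lookup_minus)
  then have "H i j \<beta> \<le> H i j (V i j + var i)" using H_S H_g'[OF ij] by (auto simp: height_plus)
  then have "Poly_Mapping.lookup \<beta> i \<le> Poly_Mapping.lookup (V i j + var i) i"
    using w by (simp add: height_def)
  moreover have "Poly_Mapping.lookup \<beta> i \<noteq> Poly_Mapping.lookup (V i j + var i) i"
    using expos_line_eqI[OF b end_expos[OF ij(1)] kB w] ne ij(2) by blast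
  ultimately have "Poly_Mapping.lookup \<beta> i < Poly_Mapping.lookup (V i j + var i) i" by simp
  from line_shift[OF end_expos[OF ij(1)] b kB w ij this] that show thesis by blast
qed

lemma inner_terms_ends:
  assumes ij: "i < n" "j < n" "i \<noteq> j" and \<beta>: "\<beta> \<in> inner_terms i j"
  obtains x y where "x > 0" "\<beta> + Poly_Mapping.single i x = V i j + var i + Poly_Mapping.single j x"
    "y > 0" "\<beta> + Poly_Mapping.single j y = V j i + var j + Poly_Mapping.single i y"
proof -
  have "\<beta> \<in> inner_terms j i" using \<beta> inner_terms_commute by simp
  then show thesis using inner_terms_end[OF ij \<beta>] inner_terms_end[of j i \<beta>] ij that by metis
qed

text \<open>
  A point between two other points of a polytope is not the unique maximum of a linear functional.
\<close>

lemma inner_terms_killed_ends_disjoint: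
  assumes ij: "i < n" "j < n" "i \<noteq> j" and l: "l < n"
  shows "inner_terms i j \<inter> killed_ends l = {}"
proof (rule ccontr)
  assume "inner_terms i j \<inter> killed_ends l \<noteq> {}"
  then obtain \<beta> h where \<beta>: "\<beta> \<in> inner_terms i j" and h: "h < n" "\<beta> = V l h + var l"
    by (auto simp: killed_ends_def)
  have less: "H l h \<gamma> < H l h \<beta>" if "\<gamma> \<in> Poly_Mapping.keys S" "\<gamma> \<noteq> \<beta>" for \<gamma>
  proof -
    have "H l h \<gamma> \<le> H l h \<beta>" using H_S[OF that(1), of l h] h by (simp add: height_plus)
    moreover have "H l h \<gamma> \<noteq> H l h \<beta>"
      using height_inj[of \<gamma> n "Suc k" \<beta> B l h] that S_expos h kB end_expos[OF l] by auto
    ultimately show ?thesis by simp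
  qed
  obtain x y where x: "x > 0" "\<beta> + Poly_Mapping.single i x = V i j + var i + Poly_Mapping.single j x"
    and y: "y > 0" "\<beta> + Poly_Mapping.single j y = V j i + var j + Poly_Mapping.single i y"
    using inner_terms_ends[OF ij \<beta>] .
  let ?d = "H l h (var i) - H l h (var j)"
  have "H l h (V i j + var i) = H l h \<beta> + int x * ?d"
    using arg_cong[OF x(2), of "H l h"] by (simp add: height_plus height_single algebra_simps)
  moreover have "H l h (V j i + var j) = H l h \<beta> - int y * ?d"
    using arg_cong[OF y(2), of "H l h"] by (simp add: height_plus height_single algebra_simps)
  moreover have "H l h (V i j + var i) < H l h \<beta>" "H l h (V j i + var j) < H l h \<beta>"
    using \<beta> ij by (intro less end_in_S; auto simp: inner_terms_def)+
  ultimately have "int x * ?d < 0" "int y * ?d > 0" by linarith+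
  then show False using x(1) y(1) by (simp add: mult_less_0_iff zero_less_mult_iff)
qed

text \<open>
  If a point strictly between the ends of an edge minimizes a second weight, so do the ends. Then the second
  weight does not distinguish \<open>x\<^sub>i\<close> from \<open>x\<^sub>j\<close>, and a generic weight does so unless it vanishes on both.
\<close>

lemma inner_terms_disjoint:
  assumes ij: "i < n" "j < n" "i \<noteq> j" and ne: "{i, j} \<noteq> {i', j'}"
  shows "inner_terms i j \<inter> inner_terms i' j' = {}"
proof (rule ccontr)
  assume "inner_terms i j \<inter> inner_terms i' j' \<noteq> {}"
  then obtain \<beta> where \<beta>: "\<beta> \<in> inner_terms i j" "\<beta> \<in> inner_terms i' j'" by auto
  obtain x y where x: "x > 0" "\<beta> + Poly_Mapping.single i x = V i j + var i + Poly_Mapping.single j x"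
    and y: "y > 0" "\<beta> + Poly_Mapping.single j y = V j i + var j + Poly_Mapping.single i y"
    using inner_terms_ends[OF ij \<beta>(1)] .
  let ?F = "W i' j'"
  have ge: "?F \<beta> \<le> ?F \<gamma>" if "\<gamma> \<in> Poly_Mapping.keys S" for \<gamma>
    using W_S[OF that, of i' j'] \<beta>(2) by (simp add: inner_terms_def)
  have "?F (V i j + var i) + x * ?F (var j) = ?F \<beta> + x * ?F (var i)"
    using arg_cong[OF x(2), of ?F] by (simp add: off_weight_plus off_weight_single)
  with ge[OF end_in_S[OF ij(1,2)]] have "x * ?F (var j) \<le> x * ?F (var i)" by linarith
  moreover have "?F (V j i + var j) + y * ?F (var i) = ?F \<beta> + y * ?F (var j)"
    using arg_cong[OF y(2), of ?F] by (simp add: off_weight_plus off_weight_single)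
  with ge[OF end_in_S[OF ij(2,1)]] have "y * ?F (var i) \<le> y * ?F (var j)" by linarith
  ultimately have "?F (var i) = ?F (var j)" using x y by simp
  then show False using ij ne kB by (auto simp: off_weight_var split: if_splits)
qed

lemma P_count:
  "(\<Sum>i<n. \<Sum>j<i. card (inner_terms i j)) + (\<Sum>i<n. card (killed_ends i)) =
    card ((\<Union>i<n. \<Union>j<i. inner_terms i j) \<union> (\<Union>i<n. killed_ends i))"
  and P_subset: "(\<Union>i<n. \<Union>j<i. inner_terms i j) \<union> (\<Union>i<n. killed_ends i) \<subseteq> Poly_Mapping.keys P"
proof -
  have fin: "finite (killed_ends i)" for i by (simp add: killed_ends_def)
  have "card (\<Union>j<i. inner_terms i j) = (\<Sum>j<i. card (inner_terms i j))" if "i < n" for i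
    by (rule card_UN_disjoint) (use that inner_terms_disjoint[of i] in \<open>auto simp: doubleton_eq_iff\<close>)
  moreover have "card (\<Union>i<n. \<Union>j<i. inner_terms i j) = (\<Sum>i<n. card (\<Union>j<i. inner_terms i j))"
  proof (rule card_UN_disjoint; (intro ballI impI)?)
    fix i i' assume i: "i \<in> {..<n}" "i' \<in> {..<n}" "i \<noteq> i'"
    have "inner_terms i j \<inter> inner_terms i' j' = {}" if "j < i" "j' < i'" for j j'
      by (rule inner_terms_disjoint) (use that i in \<open>auto simp: doubleton_eq_iff\<close>)
    then show "(\<Union>j<i. inner_terms i j) \<inter> (\<Union>j<i'. inner_terms i' j) = {}" by blast
  qed auto
  moreover have "card (\<Union>i<n. killed_ends i) = (\<Sum>i<n. card (killed_ends i))"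
    by (rule card_UN_disjoint) (use fin killed_ends_disjoint in auto)
  moreover have "(\<Union>i<n. \<Union>j<i. inner_terms i j) \<inter> (\<Union>i<n. killed_ends i) = {}"
  proof -
    have "inner_terms i j \<inter> killed_ends l = {}" if "i < n" "j < i" "l < n" for i j l
      by (rule inner_terms_killed_ends_disjoint) (use that in auto)
    then show ?thesis by blast
  qed
  ultimately show "(\<Sum>i<n. \<Sum>j<i. card (inner_terms i j)) + (\<Sum>i<n. card (killed_ends i)) =
      card ((\<Union>i<n. \<Union>j<i. inner_terms i j) \<union> (\<Union>i<n. killed_ends i))"
    using fin by (subst card_Un_disjoint) auto
  show "(\<Union>i<n. \<Union>j<i. inner_terms i j) \<union> (\<Union>i<n. killed_ends i) \<subseteq> Poly_Mapping.keys P"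
    using killed_ends_P by (auto simp: inner_terms_def)
qed

text \<open>
  The three ways in which a step can be wasteful apart from terms of \<open>P\<close> that are not charged at all. They
  are kept explicit in \<open>step_bound_slack\<close>, as the case of equality needs that each of them vanishes.
\<close>

definition "slack_wiped = (\<Sum>i<n. \<Sum>j\<in>N i. of_bool (wiped i j) * int (card (inner_terms i j)))"
definition "slack_killed = (\<Sum>i<n. int ((n - 1) * card (killed_ends i)) - int (num_killed i))"
definition "slack_tips =
  (\<Sum>i<n. int (num_tips n B i g' + card (killed_ends i) + num_wiped i) - int (num_tips n B i g + num_killed i))"

text \<open>
  The sum of \<open>pair_bound\<close> over all ordered pairs and of \<open>num_tips_bound\<close> over all \<open>i\<close>. If \<open>J\<close> points are
  killed for \<open>i\<close>, and they are the ends of \<open>C\<close> edges, then the charge \<open>2 C\<close> for these edges together with the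
  change \<open>J - C\<close> of the number of ends is \<open>C + J\<close>, and this is at most \<open>n J\<close> because \<open>C \<le> (n - 1) J\<close>.
\<close>

lemma step_bound_slack:
  "int n * (int n - 1) + potential n B g + slack_wiped + slack_killed + slack_tips
    \<le> potential n B g' + 4 * int (\<Sum>i<n. \<Sum>j<i. card (inner_terms i j)) + int n * int (\<Sum>i<n. card (killed_ends i))"
proof -
  let ?Q = "\<lambda>f. \<Sum>i<n. \<Sum>j\<in>N i. (f i j :: int)"
  have "?Q (\<lambda>i j. edge_blocks n B i j g + 1 + of_bool (wiped i j) * (int (card (inner_terms i j)) + 1))
      \<le> ?Q (\<lambda>i j. edge_blocks n B i j g' + 2 * int (card (inner_terms i j)) + of_bool (killed i j) + of_bool (killed j i))"
    by (intro sum_mono pair_bound) auto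
  moreover have "?Q (\<lambda>i j. edge_blocks n B i j g + 1 + of_bool (wiped i j) * (int (card (inner_terms i j)) + 1))
      = ?Q (\<lambda>i j. edge_blocks n B i j g) + ?Q (\<lambda>i j. 1) + slack_wiped + ?Q (\<lambda>i j. of_bool (wiped i j))"
    by (simp only: slack_wiped_def sum.distrib distrib_left mult_1_right add.assoc)
  moreover have "?Q (\<lambda>i j. 1) = int n * (int n - 1)"
    using n4 by (simp add: of_nat_diff)
  moreover have "?Q (\<lambda>i j. of_bool (wiped i j)) = (\<Sum>i<n. int (num_wiped i))"
    by (simp add: num_wiped_def sum_of_bool_eq Int_def conj_commute)
  moreover have "?Q (\<lambda>i j. edge_blocks n B i j g' + 2 * int (card (inner_terms i j)) + of_bool (killed i j) + of_bool (killed j i))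
      = ?Q (\<lambda>i j. edge_blocks n B i j g') + 2 * ?Q (\<lambda>i j. int (card (inner_terms i j)))
        + ?Q (\<lambda>i j. of_bool (killed i j)) + ?Q (\<lambda>i j. of_bool (killed j i))"
    by (simp only: sum.distrib sum_distrib_left)
  moreover have "?Q (\<lambda>i j. of_bool (killed j i)) = ?Q (\<lambda>i j. of_bool (killed i j))"
    by (rule sum_ordered_pairs_swap)
  moreover have "?Q (\<lambda>i j. of_bool (killed i j)) = (\<Sum>i<n. int (num_killed i))"
    by (simp add: num_killed_def sum_of_bool_eq Int_def conj_commute)
  moreover have "?Q (\<lambda>i j. int (card (inner_terms i j))) = 2 * int (\<Sum>i<n. \<Sum>j<i. card (inner_terms i j))"
    unfolding sum_ordered_pairs
    by (simp add: sum.distrib sum_distrib_left inner_terms_commute)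
  moreover have "potential n B g = (\<Sum>i<n. int (num_tips n B i g)) + ?Q (\<lambda>i j. edge_blocks n B i j g)"
    "potential n B g' = (\<Sum>i<n. int (num_tips n B i g')) + ?Q (\<lambda>i j. edge_blocks n B i j g')"
    by (simp_all add: potential_def sum.distrib)
  moreover have "slack_tips = (\<Sum>i<n. int (num_tips n B i g')) + (\<Sum>i<n. int (card (killed_ends i)))
      + (\<Sum>i<n. int (num_wiped i)) - (\<Sum>i<n. int (num_tips n B i g)) - (\<Sum>i<n. int (num_killed i))"
    by (simp add: slack_tips_def sum.distrib sum_subtractf)
  moreover have "slack_killed = (int n - 1) * (\<Sum>i<n. int (card (killed_ends i))) - (\<Sum>i<n. int (num_killed i))"
    using n4 by (simp add: slack_killed_def sum_subtractf sum_distrib_left of_nat_diff)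
  ultimately show ?thesis by (simp add: algebra_simps)
qed

lemma slack_nonneg: "slack_wiped \<ge> 0" "slack_killed \<ge> 0" "slack_tips \<ge> 0"
  unfolding slack_wiped_def slack_killed_def slack_tips_def
  using num_killed_le num_tips_bound by (auto intro!: sum_nonneg simp: of_nat_le_iff simp flip: of_nat_add of_nat_mult)

text \<open>
  The only place where \<open>4 \<le> n\<close> is essential for the bound: an inner term is charged twice by each of two
  ordered pairs.
\<close>

lemma count_le:
  "4 * int (\<Sum>i<n. \<Sum>j<i. card (inner_terms i j)) + int n * int (\<Sum>i<n. card (killed_ends i))
    \<le> int n * int (card ((\<Union>i<n. \<Union>j<i. inner_terms i j) \<union> (\<Union>i<n. killed_ends i)))"
proof -
  have "4 * int (\<Sum>i<n. \<Sum>j<i. card (inner_terms i j)) \<le> int n * int (\<Sum>i<n. \<Sum>j<i. card (inner_terms i j))"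
    by (rule mult_right_mono) (use n4 in simp, rule of_nat_0_le_iff)
  then show ?thesis unfolding P_count[symmetric] of_nat_add distrib_left by linarith
qed

lemma card_P_ge: "card ((\<Union>i<n. \<Union>j<i. inner_terms i j) \<union> (\<Union>i<n. killed_ends i)) \<le> card (Poly_Mapping.keys P)"
  by (rule card_mono[OF _ P_subset]) simp

lemma step_bound:
  "int n * (int n - 1) + potential n B g \<le> potential n B g' + int n * int (card (Poly_Mapping.keys P))"
proof -
  have "int n * int (card ((\<Union>i<n. \<Union>j<i. inner_terms i j) \<union> (\<Union>i<n. killed_ends i)))
      \<le> int n * int (card (Poly_Mapping.keys P))"
    by (intro mult_left_mono) (use card_P_ge in auto)
  then show ?thesis using step_bound_slack slack_nonneg count_le by linarith
qed

lemma step_tight: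
  assumes "int n * (int n - 1) + potential n B g = potential n B g' + int n * int (card (Poly_Mapping.keys P))"
  shows "Poly_Mapping.keys P = (\<Union>i<n. \<Union>j<i. inner_terms i j) \<union> (\<Union>i<n. killed_ends i)"
    and "\<And>i j. i < n \<Longrightarrow> j < n \<Longrightarrow> i \<noteq> j \<Longrightarrow> wiped i j \<Longrightarrow> inner_terms i j = {}"
    and "\<And>i. i < n \<Longrightarrow> num_killed i = (n - 1) * card (killed_ends i)"
    and "\<And>i. i < n \<Longrightarrow> num_tips n B i g + num_killed i = num_tips n B i g' + card (killed_ends i) + num_wiped i"
proof -
  let ?U = "(\<Union>i<n. \<Union>j<i. inner_terms i j) \<union> (\<Union>i<n. killed_ends i)"
  have le: "int n * int (card ?U) \<le> int n * int (card (Poly_Mapping.keys P))"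
    by (intro mult_left_mono) (use card_P_ge in auto)
  then have z: "slack_wiped = 0" "slack_killed = 0" "slack_tips = 0"
    and eq: "int n * int (card ?U) = int n * int (card (Poly_Mapping.keys P))"
    using assms step_bound_slack slack_nonneg count_le by linarith+
  from eq have "card ?U = card (Poly_Mapping.keys P)" using n4 by simp
  then show "Poly_Mapping.keys P = ?U" using card_subset_eq[OF finite_keys P_subset] by simp
  have 1: "(\<Sum>j\<in>N i. of_bool (wiped i j) * int (card (inner_terms i j))) = 0" if "i < n" for i
    using z(1) unfolding slack_wiped_def
    by (subst (asm) sum_nonneg_eq_0_iff) (use that in \<open>auto intro: sum_nonneg\<close>)
  show "inner_terms i j = {}" if "i < n" "j < n" "i \<noteq> j" "wiped i j" for i j
  proof -
    have "of_bool (wiped i j) * int (card (inner_terms i j)) = 0"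
      using 1[OF that(1)] by (subst (asm) sum_nonneg_eq_0_iff) (use that in auto)
    then show ?thesis using that by simp
  qed
  show "num_killed i = (n - 1) * card (killed_ends i)" if "i < n" for i
  proof -
    have "int ((n - 1) * card (killed_ends i)) - int (num_killed i) = 0"
      using z(2) unfolding slack_killed_def
      by (subst (asm) sum_nonneg_eq_0_iff) (use that num_killed_le in \<open>auto simp: of_nat_le_iff simp flip: of_nat_mult\<close>)
    then show ?thesis by linarith
  qed
  show "num_tips n B i g + num_killed i = num_tips n B i g' + card (killed_ends i) + num_wiped i" if "i < n" for i
  proof -
    have "int (num_tips n B i g' + card (killed_ends i) + num_wiped i) - int (num_tips n B i g + num_killed i) = 0"
      using z(3) unfolding slack_tips_def
      by (subst (asm) sum_nonneg_eq_0_iff) (use that num_tips_bound in \<open>auto simp: of_nat_le_iff simp flip: of_nat_add\<close>)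
    then show ?thesis by linarith
  qed
qed

end

section \<open>Steps without slack\<close>

lemma lookup_coord_sum_single:
  "Poly_Mapping.lookup (coord_sum n * Poly_Mapping.single c a) \<beta> = (if \<exists>i<n. \<beta> = c + var i then a else 0)"
proof (cases "\<exists>i<n. \<beta> = c + var i")
  case True
  then obtain i where i: "i < n" "\<beta> = c + var i" by auto
  have eq: "Poly_Mapping.lookup (Poly_Mapping.single c a) (\<beta> - var h) = 0"
    if "h \<noteq> i" "Poly_Mapping.lookup \<beta> h > 0" for h
  proof -
    have "\<beta> - var h \<noteq> c"
    proof
      assume "\<beta> - var h = c"
      then have "c + var h = c + var i" using minus_var_plus[OF that(2)] i by simp
      then show False using that by simp
    qed
    then show ?thesis by (simp add: lookup_single when_def)
  qed
  have "(\<Sum>h<n. if Poly_Mapping.lookup \<beta> h > 0 then Poly_Mapping.lookup (Poly_Mapping.single c a) (\<beta> - var h) else 0)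
      = (\<Sum>h<n. if h = i then a else 0)"
    using i eq by (intro sum.cong refl) (auto simp: lookup_add lookup_var)
  then show ?thesis unfolding lookup_coord_sum_mult using True i(1) by simp
next
  case False
  have "\<beta> \<notin> Poly_Mapping.keys (coord_sum n * Poly_Mapping.single c a)"
    using False by (auto elim!: keys_coord_sum_mult split: if_splits)
  then show ?thesis unfolding in_keys_iff using False by (simp only: if_False not_not)
qed

lemma single_Suc_eq_iff: "Poly_Mapping.single i (Suc m) = Poly_Mapping.single j (Suc m) \<longleftrightarrow> i = j"
  by (metis keys_single nat.distinct(1) singleton_inject)

lemma mono_eval_nonzero:
  assumes "\<And>i. i \<in> Poly_Mapping.keys c \<Longrightarrow> x i \<noteq> 0"
  shows "mono_eval x c \<noteq> 0"
  unfolding mono_eval_def using assms by simp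

lemma mono_eval_single: "mono_eval x (Poly_Mapping.single i m) = x i ^ m"
  by (subst mono_eval_superset[of "{i}"]) auto

text \<open>
  A monomial factor can be divided out of a polynomial that vanishes on the hyperplane: the factor is nonzero
  at generic points of the hyperplane, and the quotient is continuous.
\<close>

lemma hyperplane_divide_monomial:
  assumes "n \<ge> 2" and c: "Poly_Mapping.keys c \<subseteq> {..<n}"
    and above: "\<And>\<beta>. \<beta> \<in> Poly_Mapping.keys s \<Longrightarrow> c + (\<beta> - c) = \<beta>"
    and van: "\<And>x. (\<Sum>i<n. x i) = 0 \<Longrightarrow> poly_eval s x = 0"
    and x: "(\<Sum>i<n. x i) = 0"
  shows "(\<Sum>\<beta>\<in>Poly_Mapping.keys s. Poly_Mapping.lookup s \<beta> * mono_eval x (\<beta> - c)) = 0"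
proof -
  define \<phi> where "\<phi> x = (\<Sum>\<beta>\<in>Poly_Mapping.keys s. Poly_Mapping.lookup s \<beta> * mono_eval x (\<beta> - c))"
    for x :: "nat \<Rightarrow> real"
  have eval: "poly_eval s x = mono_eval x c * \<phi> x" for x
  proof -
    have "poly_eval s x = (\<Sum>\<beta>\<in>Poly_Mapping.keys s. Poly_Mapping.lookup s \<beta> * mono_eval x (c + (\<beta> - c)))"
      using above by (simp add: poly_eval_superset[OF finite_keys order_refl])
    then show ?thesis by (simp add: \<phi>_def mono_eval_plus sum_distrib_left mult_ac)
  qed
  \<comment> \<open>a direction inside the hyperplane with no zero coordinate, to leave the coordinate hyperplanes\<close>
  define y where "y i = (if i = 0 then - (real n - 1) else 1)" for i :: nat
  have y0: "(\<Sum>i<n. y i) = 0"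
    using \<open>n \<ge> 2\<close> by (simp add: sum.remove[of "{..<n}" 0] y_def of_nat_diff)
  have lim: "((\<lambda>\<epsilon>. \<phi> (\<lambda>i. x i + \<epsilon> * y i)) \<longlongrightarrow> \<phi> (\<lambda>i. x i + 0 * y i)) (at_right 0)"
    unfolding \<phi>_def mono_eval_def by (intro tendsto_intros)
  have ev: "\<forall>\<^sub>F \<epsilon> in at_right 0. \<phi> (\<lambda>i. x i + \<epsilon> * y i) = 0"
  proof -
    have "\<forall>\<^sub>F \<epsilon> in at_right 0. x i + \<epsilon> * y i \<noteq> 0" if "i < n" for i
    proof (cases "x i = 0")
      case True
      have "y i \<noteq> 0" using \<open>n \<ge> 2\<close> by (simp add: y_def)
      then show ?thesis using True eventually_at_right_less[of "0::real"] by (auto elim!: eventually_mono)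
    next
      case False
      have "((\<lambda>\<epsilon>. x i + \<epsilon> * y i) \<longlongrightarrow> x i + 0 * y i) (at_right 0)" by (intro tendsto_intros)
      then show ?thesis using False tendsto_imp_eventually_ne by fastforce
    qed
    then have "\<forall>\<^sub>F \<epsilon> in at_right 0. \<forall>i\<in>{..<n}. x i + \<epsilon> * y i \<noteq> 0"
      by (intro eventually_ball_finite) auto
    then show ?thesis
    proof eventually_elim
      case (elim \<epsilon>)
      have "(\<Sum>i<n. x i + \<epsilon> * y i) = 0" using x y0 by (simp add: sum.distrib flip: sum_distrib_left)
      then have "mono_eval (\<lambda>i. x i + \<epsilon> * y i) c * \<phi> (\<lambda>i. x i + \<epsilon> * y i) = 0"
        using van eval by metis
      moreover have "mono_eval (\<lambda>i. x i + \<epsilon> * y i) c \<noteq> 0"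
        using elim c by (intro mono_eval_nonzero) auto
      ultimately show ?case by simp
    qed
  qed
  have "\<phi> (\<lambda>i. x i + 0 * y i) = 0"
    by (rule tendsto_unique[OF trivial_limit_at_right_real lim tendsto_eventually[OF ev]])
  then show ?thesis by (simp add: \<phi>_def)
qed

text \<open>
  A positive combination of at least three \<open>M\<close>-th powers vanishes on \<open>\<Sum>x\<^sub>i = 0\<close> only for \<open>M = 1\<close>. With only
  two variables, \<open>x ^ M + y ^ M\<close> would be divisible by \<open>x + y\<close> for every odd \<open>M\<close>.
\<close>

lemma power_sum_vanishing:
  assumes "card A \<ge> 3" "finite A" and pos: "\<And>i. i \<in> A \<Longrightarrow> a i > (0::real)"
    and M: "M > 0"
    and van: "\<And>x :: 'a \<Rightarrow> real. (\<And>i. i \<notin> A \<Longrightarrow> x i = 0) \<Longrightarrow> (\<Sum>i\<in>A. x i) = 0 \<Longrightarrow> (\<Sum>i\<in>A. a i * x i ^ M) = 0"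
  shows "M = 1"
proof -
  obtain T where T: "T \<subseteq> A" "card T = 3" using obtain_subset_with_card_n[OF assms(1)] by metis
  then obtain p q r where pqr: "T = {p, q, r}" "p \<noteq> q" "q \<noteq> r" "p \<noteq> r"
    unfolding card_3_iff by auto
  then have in_A: "p \<in> A" "q \<in> A" "r \<in> A" using T by auto
  have key: "a p * u ^ M + a q * v ^ M + a r * w ^ M = 0" if "u + v + w = 0" for u v w
  proof -
    define x where "x i = (if i = p then u else if i = q then v else if i = r then w else 0)" for i
    have s: "(\<Sum>i\<in>A. f (x i) i) = f u p + f v q + f w r" if "\<And>i. f 0 i = (0::real)" for f
    proof -
      have "(\<Sum>i\<in>A. f (x i) i) = (\<Sum>i\<in>{p, q, r}. f (x i) i)"
        by (rule sum.mono_neutral_right) (use in_A assms(2) that in \<open>auto simp: x_def\<close>)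
      then show ?thesis using pqr by (simp add: x_def)
    qed
    have "(\<Sum>i\<in>A. x i) = 0" using s[of "\<lambda>t i. t"] that by simp
    then have "(\<Sum>i\<in>A. a i * x i ^ M) = 0" by (intro van) (use in_A in \<open>auto simp: x_def\<close>)
    then show ?thesis using s[of "\<lambda>t i. a i * t ^ M"] M by (simp add: zero_power)
  qed
  \<comment> \<open>the point \<open>(1, -1, 0)\<close> shows that \<open>M\<close> is odd and the coefficients are equal; then \<open>(2, -1, -1)\<close>
    gives \<open>2 ^ M = 2\<close>\<close>
  have odd: "odd M"
  proof (rule ccontr)
    assume "\<not> odd M"
    then show False using key[of 1 "-1" 0] pos[OF in_A(1)] pos[OF in_A(2)] M by (simp add: zero_power)
  qed
  have "a p = a q" "a p = a r" using key[of 1 "-1" 0] key[of 1 0 "-1"] odd M by (simp_all add: zero_power)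
  then have "a p * 2 ^ M = a p * 2" using key[of 2 "-1" "-1"] odd by (simp add: algebra_simps)
  then have "(2::real) ^ M = 2 ^ 1" using pos[OF in_A(1)] by simp
  then show "M = 1" by (metis one_less_numeral_iff power_inject_exp semiring_norm(76))
qed

text \<open>
  A step in which the bound is attained, with \<open>g'\<close> zero or a monomial. The aim is to show that \<open>g\<close> is a
  monomial as well.
\<close>

locale tight_step = growth_step +
  fixes c' :: "nat \<Rightarrow>\<^sub>0 nat"
  assumes tight: "int n * (int n - 1) + potential n B g = potential n B g' + int n * int (card (Poly_Mapping.keys P))"
    and g'_keys: "Poly_Mapping.keys g' \<subseteq> {c'}"
begin

lemmas tight_facts = step_tight[OF tight]

text \<open>
  Equality in \<open>C \<le> (n - 1) J\<close> leaves two possibilities: \<open>J = 0\<close>, or all \<open>n - 1\<close> edges for \<open>i\<close> share their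
  end and this end is killed.
\<close>

lemma killed_all_or_none:
  assumes "i < n"
  shows "(\<forall>j\<in>N i. killed i j) \<and> card (killed_ends i) = 1 \<and> num_killed i = n - 1 \<or>
    (\<forall>j\<in>N i. \<not> killed i j)"
proof (cases "card (killed_ends i) = 0")
  case True
  then have "killed_ends i = {}" by (simp add: killed_ends_def)
  then show ?thesis by (auto simp: killed_ends_def)
next
  case False
  have cN: "card (N i) = n - 1" using assms by simp
  have le: "num_killed i \<le> n - 1"
    unfolding num_killed_def cN[symmetric] by (intro card_mono) auto
  moreover have eq: "num_killed i = (n - 1) * card (killed_ends i)" using tight_facts(3)[OF assms] .
  ultimately have "card (killed_ends i) \<le> 1" using n4 by (metis One_nat_def diff_is_0_eq' leD mult.right_neutral
        mult_le_cancel1 not_le zero_less_diff numeral_le_one_iff order_trans semiring_norm(69))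
  with False have 1: "card (killed_ends i) = 1" by simp
  with eq have nk: "num_killed i = n - 1" by simp
  have "{j \<in> N i. killed i j} = N i"
    by (rule card_subset_eq) (use nk cN in \<open>auto simp: num_killed_def\<close>)
  then show ?thesis using 1 nk by blast
qed

definition "v i = V i (if i = 0 then 1 else 0)"

text \<open>
  In both cases of the previous lemma all edges for \<open>i\<close> have a common end: either it is killed for all of
  them, or it survives in \<open>g'\<close>, which has at most one term.
\<close>

lemma V_eq_v:
  assumes "i < n" "j < n" "i \<noteq> j"
  shows "V i j = v i"
proof -
  define l where "l = (if i = 0 then 1 else 0 :: nat)"
  have l: "l \<in> N i" using n4 by (auto simp: l_def)
  have j: "j \<in> N i" using assms by auto
  consider "\<forall>j\<in>N i. killed i j" "card (killed_ends i) = 1" | "\<forall>j\<in>N i. \<not> killed i j"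
    using killed_all_or_none[OF assms(1)] by blast
  then have "V i j + var i = V i l + var i"
  proof cases
    case 1
    then have "V i j + var i \<in> killed_ends i" "V i l + var i \<in> killed_ends i"
      using l j by (auto simp: killed_ends_def)
    then show ?thesis using 1(2) by (metis card_1_singletonE singletonD)
  next
    case 2
    then have "V i j + var i \<in> {c'}" "V i l + var i \<in> {c'}"
      using l j g'_keys unfolding killed_def by blast+
    then show ?thesis by simp
  qed
  then show ?thesis by (simp add: v_def l_def)
qed

lemma v_expos: "v i \<in> expos n k" by (simp add: v_def V_expos)

lemma v_coord_eq:
  assumes "i < n" "j < n" "i \<noteq> j" "h \<noteq> i" "h \<noteq> j"
  shows "Poly_Mapping.lookup (v i) h = Poly_Mapping.lookup (v j) h"
proof -
  have "W i j (v i) = W i j (v j)"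
    using W_V_commute[of i j] V_eq_v[of i j] V_eq_v[of j i] assms by simp
  then show ?thesis using off_weight_eq_lookup[OF v_expos v_expos kB'] assms by metis
qed

text \<open>
  The common ends \<open>v i\<close> are joined by edges in the directions \<open>e\<^sub>i - e\<^sub>j\<close>, so they are the vertices
  \<open>c + m e\<^sub>i\<close> of a simplex.
\<close>

definition "m = Poly_Mapping.lookup (v 0) 0 - Poly_Mapping.lookup (v 1) 0"

definition "c = v 0 - Poly_Mapping.single 0 m"

lemma v_1_le_v_0: "Poly_Mapping.lookup (v 1) 0 \<le> Poly_Mapping.lookup (v 0) 0"
  using line_le[OF V_in W_V_commute[of 0 1]] V_eq_v[of 0 1] V_eq_v[of 1 0] n4 by simp

lemma lookup_c: "Poly_Mapping.lookup c h = (if h = 0 then Poly_Mapping.lookup (v 1) 0 else Poly_Mapping.lookup (v 0) h)"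
  using v_1_le_v_0 by (simp add: c_def m_def lookup_minus lookup_single when_def)

lemma v_0: "v 0 = c + Poly_Mapping.single 0 m"
  using v_1_le_v_0
  by (intro poly_mapping_eqI) (simp add: lookup_add lookup_c lookup_single when_def m_def)

lemma c_keys: "Poly_Mapping.keys c \<subseteq> {..<n}" and c_degree: "expo_degree c + m = k"
proof -
  have "Poly_Mapping.keys c \<subseteq> Poly_Mapping.keys (v 0)" unfolding v_0 keys_plus_nat by blast
  then show "Poly_Mapping.keys c \<subseteq> {..<n}" using v_expos[of 0] by (auto simp: expos_def)
  have "expo_degree (Poly_Mapping.single (0::nat) m) = m" by (simp add: expo_degree_def)
  then show "expo_degree c + m = k"
    using v_expos[of 0] unfolding v_0 expos_def by (simp add: expo_degree_plus)
qed

lemma v_eq: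
  assumes "i < n"
  shows "v i = c + Poly_Mapping.single i m"
proof (rule expos_eqI[OF v_expos _ assms])
  have "expo_degree (Poly_Mapping.single i m) = m" by (simp add: expo_degree_def)
  then show "c + Poly_Mapping.single i m \<in> expos n k"
    using c_keys c_degree assms by (auto simp: expos_def expo_degree_plus keys_plus_nat split: if_splits)
  fix h assume h: "h < n" "h \<noteq> i"
  show "Poly_Mapping.lookup (v i) h = Poly_Mapping.lookup (c + Poly_Mapping.single i m) h"
  proof (cases "h = 0")
    case True
    then have "Poly_Mapping.lookup (v i) 0 = Poly_Mapping.lookup (v 1) 0"
      using v_coord_eq[of i 1 0] assms h n4 by (cases "i = 1") auto
    then show ?thesis using True h by (simp add: lookup_add lookup_c lookup_single when_def)
  next
    case False
    then have "Poly_Mapping.lookup (v i) h = Poly_Mapping.lookup (v 0) h"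
      using v_coord_eq[of i 0 h] assms h n4 by (cases "i = 0") auto
    then show ?thesis using False h by (simp add: lookup_add lookup_c lookup_single when_def)
  qed
qed

lemma end_eq:
  assumes "i < n" "j < n" "i \<noteq> j"
  shows "V i j + var i = c + Poly_Mapping.single i (Suc m)"
  unfolding V_eq_v[OF assms] v_eq[OF assms(1)]
  by (rule poly_mapping_eqI) (simp add: lookup_add lookup_var lookup_single when_def)

lemma killed_iff:
  assumes "i < n" "j < n" "i \<noteq> j"
  shows "killed i j \<longleftrightarrow> c + Poly_Mapping.single i (Suc m) \<notin> Poly_Mapping.keys g'"
  by (simp add: killed_def end_eq[OF assms])

lemma num_tips_one: "i < n \<Longrightarrow> num_tips n B i g = 1"
proof -
  assume i: "i < n"
  have ne: "(if i = 0 then 1 else 0) \<in> N i" using n4 by auto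
  have "(\<lambda>j. V i j) ` N i = {v i}" using V_eq_v[OF i] ne by (auto simp: image_def)
  then show ?thesis using g_nz by (simp add: num_tips_def)
qed

lemma num_tips'_one: "i < n \<Longrightarrow> g' \<noteq> 0 \<Longrightarrow> num_tips n B i g' = 1"
proof -
  assume i: "i < n" and nz: "g' \<noteq> 0"
  have ne: "(if i = 0 then 1 else 0) \<in> N i" using n4 by auto
  have "V' i j = c'" for j using V'_in[OF nz, of i j] g'_keys by auto
  then have "(\<lambda>j. V' i j) ` N i = {c'}" using ne by (auto simp: image_def)
  then show ?thesis using nz by (simp add: num_tips_def)
qed

lemma num_wiped_eq:
  assumes "i < n" "g' \<noteq> 0" "j < n" "i \<noteq> j" "killed i j"
  shows "num_wiped i = n - 2"
proof -
  have "card (killed_ends i) = 1" "num_killed i = n - 1"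
    using killed_all_or_none[OF assms(1)] assms by auto
  then show ?thesis using tight_facts(4)[OF assms(1)] num_tips_one num_tips'_one assms n4 by simp
qed

text \<open>
  Suppose that all ends are killed. Then for every \<open>i\<close> exactly one edge \<open>(i, \<pi> i)\<close> is not wiped out, and it
  contains the only exponent \<open>c'\<close> of \<open>g'\<close>. As \<open>n \<ge> 4\<close>, two of these edges have no
  vertex of the simplex in common, so \<open>c'\<close> cannot be on both.
\<close>

lemma some_end_survives:
  assumes "g' \<noteq> 0"
  shows "\<exists>z<n. c + Poly_Mapping.single z (Suc m) \<in> Poly_Mapping.keys g'"
proof (rule ccontr)
  assume "\<not> ?thesis"
  then have kd: "killed i j" if "i < n" "j < n" "i \<noteq> j" for i j using killed_iff that by blast
  have "card {j \<in> N i. \<not> wiped i j} = 1" if "i < n" for i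
  proof -
    have "num_wiped i = n - 2"
      by (rule num_wiped_eq[OF that assms, of "if i = 0 then 1 else 0"]) (use kd that n4 in auto)
    moreover have "card (N i) = num_wiped i + card {j \<in> N i. \<not> wiped i j}"
      unfolding num_wiped_def by (subst card_Un_disjoint[symmetric]) (auto intro: arg_cong[of _ _ card])
    ultimately show ?thesis using that n4 by simp
  qed
  then have "\<exists>j. {j \<in> N i. \<not> wiped i j} = {j}" if "i < n" for i using that by (meson card_1_singletonE)
  then obtain \<pi> where \<pi>: "\<And>i. i < n \<Longrightarrow> {j \<in> N i. \<not> wiped i j} = {\<pi> i}" by metis
  have \<pi>_props: "\<pi> i < n" "\<pi> i \<noteq> i" "\<not> wiped i (\<pi> i)" if "i < n" for i using \<pi>[OF that] by auto
  have \<pi>_uniq: "j = \<pi> i" if "i < n" "j < n" "i \<noteq> j" "\<not> wiped i j" for i j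
    using \<pi>[OF that(1)] that by auto
  have coord: "Poly_Mapping.lookup c' h = Poly_Mapping.lookup c h" if "i < n" "h \<noteq> i" "h \<noteq> \<pi> i" for i h
  proof -
    have "V' i (\<pi> i) = c'" using V'_in[OF assms, of i "\<pi> i"] g'_keys by auto
    then have "W i (\<pi> i) c' = W i (\<pi> i) (V i (\<pi> i) + var i)"
      using \<pi>_props[OF that(1)] assms by (auto simp: wiped_def W_end)
    moreover have "c' \<in> expos n (Suc k)" using V'_expos[OF assms, of i "\<pi> i"] \<open>V' i (\<pi> i) = c'\<close> by simp
    ultimately have "Poly_Mapping.lookup c' h = Poly_Mapping.lookup (V i (\<pi> i) + var i) h"
      using off_weight_eq_lookup end_expos[OF that(1)] kB that by blast
    also have "\<dots> = Poly_Mapping.lookup c h"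
      using end_eq[of i "\<pi> i"] \<pi>_props[OF that(1)] that by (simp add: lookup_add lookup_single when_def)
    finally show ?thesis .
  qed
  have "\<exists>l<n. l \<noteq> 0 \<and> l \<noteq> \<pi> 0"
  proof (cases "\<pi> 0 = 1")
    case True then show ?thesis using n4 by (intro exI[of _ 2]) auto
  next
    case False then show ?thesis using n4 by (intro exI[of _ 1]) auto
  qed
  then obtain l where l: "l < n" "l \<noteq> 0" "l \<noteq> \<pi> 0" by auto
  have n0: "0 < n" using n4 by simp
  have "\<pi> l \<noteq> 0"
  proof
    assume "\<pi> l = 0"
    then have "\<not> wiped 0 l" using \<pi>_props[OF l(1)] wiped_commute[of 0 l] l n0 by auto
    then show False using \<pi>_uniq[OF n0 l(1)] l by auto
  qed
  moreover have "\<pi> l \<noteq> \<pi> 0"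
  proof
    assume eq: "\<pi> l = \<pi> 0"
    have "\<not> wiped (\<pi> 0) l" "\<not> wiped (\<pi> 0) 0"
      using \<pi>_props[OF l(1)] \<pi>_props[OF n0] wiped_commute[of "\<pi> 0"] l n0 eq by metis+
    then have "l = \<pi> (\<pi> 0)" "0 = \<pi> (\<pi> 0)" using \<pi>_uniq \<pi>_props[OF n0] l n0 by metis+
    then show False using l by simp
  qed
  ultimately have "Poly_Mapping.lookup c' h = Poly_Mapping.lookup c h" for h
    using coord[OF n0, of h] coord[OF l(1), of h] l by (cases "h = 0 \<or> h = \<pi> 0") auto
  then have "c' = c" by (rule poly_mapping_eqI)
  moreover have "expo_degree c' = Suc k"
    using V'_in[OF assms, of 0 1] V'_expos[OF assms, of 0 1] g'_keys by (auto simp: expos_def)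
  ultimately show False using c_degree by simp
qed

text \<open>
  If \<open>g'\<close> is not zero, its only term is the surviving vertex \<open>z\<close>. Every edge not at \<open>z\<close> is wiped out, and a
  wiped edge has no inner terms in a tight step. If \<open>g' = 0\<close>, all edges are wiped out and any \<open>z\<close> will do.
\<close>

lemma surviving_end:
  obtains z where "Poly_Mapping.keys g' \<subseteq> {c + Poly_Mapping.single z (Suc m)}" "z < n"
    "\<And>i j. i < n \<Longrightarrow> j < n \<Longrightarrow> i \<noteq> j \<Longrightarrow> i \<noteq> z \<Longrightarrow> j \<noteq> z \<Longrightarrow> inner_terms i j = {}"
proof (cases "g' = 0")
  case True
  then have w: "wiped i j" for i j unfolding wiped_def by blast
  show thesis
    by (rule that[of 0]) (use True n4 w tight_facts(2) in auto)
next
  case False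
  obtain z where z: "z < n" "c + Poly_Mapping.single z (Suc m) \<in> Poly_Mapping.keys g'"
    using some_end_survives[OF False] by auto
  then have keys: "Poly_Mapping.keys g' = {c + Poly_Mapping.single z (Suc m)}" using g'_keys by auto
  show thesis
  proof (rule that[of z])
    fix i j assume ij: "i < n" "j < n" "i \<noteq> j" "i \<noteq> z" "j \<noteq> z"
    have k: "killed i z" using killed_iff[of i z] keys ij z by (auto simp: single_Suc_eq_iff)
    have "\<not> killed z i" using killed_iff[of z i] z ij by auto
    then have nw: "\<not> wiped i z" using wiped_killed(2)[of i z] ij z by auto
    have "card (N i - {z}) = n - 2" using ij z by (simp add: card_Diff_singleton)
    moreover have "num_wiped i = n - 2" using num_wiped_eq[OF ij(1) False z(1)] ij k by simp
    moreover have "{j \<in> N i. wiped i j} \<subseteq> N i - {z}" using nw by auto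
    ultimately have "{j \<in> N i. wiped i j} = N i - {z}"
      unfolding num_wiped_def by (intro card_subset_eq) auto
    then have "wiped i j" using ij by blast
    then show "inner_terms i j = {}" using tight_facts(2) ij by blast
  qed (use keys z in auto)
qed

lemma inner_terms_form:
  assumes ij: "i < n" "j < n" "i \<noteq> j" and \<beta>: "\<beta> \<in> inner_terms i j"
  obtains x y where "x > 0" "y > 0" "x + y = Suc m"
    "\<beta> = c + (Poly_Mapping.single i x + Poly_Mapping.single j y)"
proof -
  obtain x y where x: "x > 0" "\<beta> + Poly_Mapping.single i x = V i j + var i + Poly_Mapping.single j x"
    and y: "y > 0" "\<beta> + Poly_Mapping.single j y = V j i + var j + Poly_Mapping.single i y"
    using inner_terms_ends[OF ij \<beta>] .
  have xl: "Poly_Mapping.lookup \<beta> h + Poly_Mapping.lookup (Poly_Mapping.single i x) h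
      = Poly_Mapping.lookup c h + Poly_Mapping.lookup (Poly_Mapping.single i (Suc m)) h
        + Poly_Mapping.lookup (Poly_Mapping.single j x) h" for h
    using arg_cong[OF x(2), of "\<lambda>p. Poly_Mapping.lookup p h"] unfolding end_eq[OF ij] by (simp only: lookup_add)
  have yl: "Poly_Mapping.lookup \<beta> h + Poly_Mapping.lookup (Poly_Mapping.single j y) h
      = Poly_Mapping.lookup c h + Poly_Mapping.lookup (Poly_Mapping.single j (Suc m)) h
        + Poly_Mapping.lookup (Poly_Mapping.single i y) h" for h
    using arg_cong[OF y(2), of "\<lambda>p. Poly_Mapping.lookup p h"] end_eq[of j i] ij by (simp add: lookup_add)
  have "x + y = Suc m" using xl[of i] yl[of i] ij by (simp add: lookup_single when_def)
  moreover have "\<beta> = c + (Poly_Mapping.single i y + Poly_Mapping.single j x)"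
  proof (rule poly_mapping_eqI)
    fix h
    show "Poly_Mapping.lookup \<beta> h = Poly_Mapping.lookup (c + (Poly_Mapping.single i y + Poly_Mapping.single j x)) h"
      using xl[of h] yl[of h] ij by (auto simp: lookup_add lookup_single when_def split: if_splits)
  qed
  ultimately show thesis using that[of y x] x(1) y(1) by simp
qed

text \<open>
  In a tight step all terms of \<open>P\<close> are killed ends or inner terms, which locates all terms of \<open>s g\<close>.
\<close>

lemma keys_S_form:
  assumes \<beta>: "\<beta> \<in> Poly_Mapping.keys S"
    and keys: "Poly_Mapping.keys g' \<subseteq> {c + Poly_Mapping.single z (Suc m)}" and z: "z < n"
    and none: "\<And>i j. i < n \<Longrightarrow> j < n \<Longrightarrow> i \<noteq> j \<Longrightarrow> i \<noteq> z \<Longrightarrow> j \<noteq> z \<Longrightarrow> inner_terms i j = {}"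
  shows "(\<exists>i<n. \<beta> = c + Poly_Mapping.single i (Suc m)) \<or>
    (\<exists>i x y. x > 0 \<and> y > 0 \<and> x + y = Suc m \<and> \<beta> = c + (Poly_Mapping.single z x + Poly_Mapping.single i y))"
proof -
  have "\<beta> \<in> Poly_Mapping.keys g' \<or> \<beta> \<in> Poly_Mapping.keys P"
    using \<beta> unfolding in_keys_iff lookup_minus by linarith
  then consider "\<beta> \<in> Poly_Mapping.keys g'" | "\<beta> \<in> Poly_Mapping.keys P" by blast
  then show ?thesis
  proof cases
    case 1
    then show ?thesis using keys z by auto
  next
    case 2
    then consider i j where "i < n" "j < i" "\<beta> \<in> inner_terms i j" | i where "i < n" "\<beta> \<in> killed_ends i"
      unfolding tight_facts(1) by auto
    then show ?thesis
    proof cases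
      case 1
      then have "i = z \<or> j = z" using none[of i j] by auto
      then show ?thesis
        using inner_terms_form[of z i \<beta>] inner_terms_form[of z j \<beta>] inner_terms_commute[of i j] 1 z
        by (metis less_imp_neq less_trans)
    next
      case 2
      then obtain j where "j < n" "j \<noteq> i" "\<beta> = V i j + var i" by (auto simp: killed_ends_def)
      then show ?thesis using end_eq 2 by metis
    qed
  qed
qed

lemma S_end_pos: "i < n \<Longrightarrow> Poly_Mapping.lookup S (c + Poly_Mapping.single i (Suc m)) > 0"
proof -
  assume i: "i < n"
  define j where "j = (if i = 0 then 1 else 0 :: nat)"
  have j: "j < n" "i \<noteq> j" using n4 by (auto simp: j_def)
  show ?thesis using S_end[OF i j(1)] top_pos[OF i j] end_eq[OF i j] by simp
qed

text \<open>
  On \<open>s = 0\<close>, after division by the monomial with exponent \<open>c\<close> and with \<open>x\<^sub>z = 0\<close>, only the terms at the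
  vertices other than \<open>z\<close> remain of \<open>s g\<close>. They form a vanishing combination of \<open>(m + 1)\<close>-th powers.
\<close>

lemma m_zero: "m = 0"
proof -
  obtain z where keys: "Poly_Mapping.keys g' \<subseteq> {c + Poly_Mapping.single z (Suc m)}" and z: "z < n"
    and none: "\<And>i j. i < n \<Longrightarrow> j < n \<Longrightarrow> i \<noteq> j \<Longrightarrow> i \<noteq> z \<Longrightarrow> j \<noteq> z \<Longrightarrow> inner_terms i j = {}"
    using surviving_end by metis
  note form = keys_S_form[OF _ keys z none]
  let ?e = "\<lambda>i. c + Poly_Mapping.single i (Suc m)"
  let ?a = "\<lambda>i. Poly_Mapping.lookup S (?e i)"
  have "Suc m = 1"
  proof (rule power_sum_vanishing[of "N z" ?a])
    show "card (N z) \<ge> 3" using z n4 by simp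
    show "?a i > 0" if "i \<in> N z" for i using S_end_pos that by auto
    fix x :: "nat \<Rightarrow> real"
    assume x: "\<And>i. i \<notin> N z \<Longrightarrow> x i = 0" and s: "(\<Sum>i\<in>N z. x i) = 0"
    then have xz: "x z = 0" by blast
    then have s': "(\<Sum>i<n. x i) = 0" using s z by (simp add: sum.remove[of "{..<n}" z])
    have "(\<Sum>\<beta>\<in>Poly_Mapping.keys S. Poly_Mapping.lookup S \<beta> * mono_eval x (\<beta> - c)) = 0"
    proof (rule hyperplane_divide_monomial[OF _ c_keys _ _ s'])
      show "c + (\<beta> - c) = \<beta>" if "\<beta> \<in> Poly_Mapping.keys S" for \<beta>
        using form[OF that] by auto
    qed (use n4 in \<open>auto simp: poly_eval_coord_sum_mult\<close>)
    also have "(\<Sum>\<beta>\<in>Poly_Mapping.keys S. Poly_Mapping.lookup S \<beta> * mono_eval x (\<beta> - c))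
        = (\<Sum>\<beta>\<in>?e ` N z. Poly_Mapping.lookup S \<beta> * mono_eval x (\<beta> - c))"
    proof (rule sum.mono_neutral_right)
      show "?e ` N z \<subseteq> Poly_Mapping.keys S"
      proof
        fix \<beta> assume "\<beta> \<in> ?e ` N z"
        then obtain i where "i < n" "\<beta> = ?e i" by auto
        then show "\<beta> \<in> Poly_Mapping.keys S" using S_end_pos[of i] unfolding in_keys_iff by simp
      qed
      show "\<forall>\<beta>\<in>Poly_Mapping.keys S - ?e ` N z. Poly_Mapping.lookup S \<beta> * mono_eval x (\<beta> - c) = 0"
      proof
        fix \<beta> assume \<beta>: "\<beta> \<in> Poly_Mapping.keys S - ?e ` N z"
        then consider "\<beta> = ?e z" | i x y where "x > 0" "\<beta> = c + (Poly_Mapping.single z x + Poly_Mapping.single i y)"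
          using form[of \<beta>] by auto
        then have "mono_eval x (\<beta> - c) = 0"
          by cases (simp_all add: mono_eval_plus mono_eval_single xz)
        then show "Poly_Mapping.lookup S \<beta> * mono_eval x (\<beta> - c) = 0" by simp
      qed
    qed simp
    also have "\<dots> = (\<Sum>i\<in>N z. ?a i * x i ^ Suc m)"
      by (subst sum.reindex) (auto simp: inj_on_def single_Suc_eq_iff mono_eval_single)
    finally show "(\<Sum>i\<in>N z. ?a i * x i ^ Suc m) = 0" .
  qed auto
  then show ?thesis by simp
qed

text \<open>
  For \<open>m = 0\<close> all ends coincide with \<open>c\<close>, so that \<open>s g\<close> is \<open>s\<close> times the term of \<open>g\<close> at \<open>c\<close>; cancel \<open>s\<close>.
\<close>

lemma g_monomial: "\<exists>c a. a > 0 \<and> g = Poly_Mapping.single c a"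
proof (intro exI conjI)
  let ?a = "Poly_Mapping.lookup g c"
  have v: "v i = c" if "i < n" for i using v_eq[OF that] by (simp add: m_zero)
  show pos: "?a > 0" using top_pos[of 0 1] V_eq_v[of 0 1] v[of 0] n4 by simp
  obtain z where keys: "Poly_Mapping.keys g' \<subseteq> {c + Poly_Mapping.single z (Suc m)}" and z: "z < n"
    and none: "\<And>i j. i < n \<Longrightarrow> j < n \<Longrightarrow> i \<noteq> j \<Longrightarrow> i \<noteq> z \<Longrightarrow> j \<noteq> z \<Longrightarrow> inner_terms i j = {}"
    using surviving_end by metis
  have "S = coord_sum n * Poly_Mapping.single c ?a"
  proof (rule poly_mapping_eqI)
    fix \<beta>
    show "Poly_Mapping.lookup S \<beta> = Poly_Mapping.lookup (coord_sum n * Poly_Mapping.single c ?a) \<beta>"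
    proof (cases "\<exists>i<n. \<beta> = c + var i")
      case True
      then obtain i where i: "i < n" "\<beta> = c + var i" by auto
      define j where "j = (if i = 0 then 1 else 0 :: nat)"
      have j: "j < n" "i \<noteq> j" using n4 by (auto simp: j_def)
      have "Poly_Mapping.lookup S \<beta> = ?a"
        using S_end[OF i(1) j(1)] V_eq_v[OF i(1) j] v[OF i(1)] i by simp
      then show ?thesis using True by (simp add: lookup_coord_sum_single)
    next
      case False
      then have "\<beta> \<notin> Poly_Mapping.keys S"
        using keys_S_form[OF _ keys z none, of \<beta>] by (auto simp: m_zero var_def)
      then show ?thesis
        unfolding in_keys_iff lookup_coord_sum_single using False by (simp only: if_False not_not)
    qed
  qed
  then show "g = Poly_Mapping.single c ?a" using coord_sum_nonzero n4 by simp
qed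

end

section \<open>The degree recursion and the theorem\<close>

definition hom_part :: "nat \<Rightarrow> rpoly \<Rightarrow> rpoly" where
  "hom_part k p = Poly_Mapping.mapp (\<lambda>\<alpha> a. if expo_degree \<alpha> = k then a else 0) p"

text \<open>
  The homogeneous parts of \<open>(p - 1) / (s - 1)\<close>. The recursion makes sense for every \<open>p\<close>; the division leaves
  no remainder exactly if the parts vanish from the degree of \<open>p\<close> on.
\<close>

fun quot_part :: "nat \<Rightarrow> rpoly \<Rightarrow> nat \<Rightarrow> rpoly" where
  "quot_part n p 0 = 1 - hom_part 0 p"
| "quot_part n p (Suc k) = coord_sum n * quot_part n p k - hom_part (Suc k) p"

lemma lookup_hom_part:
  "Poly_Mapping.lookup (hom_part k p) \<alpha> = (if expo_degree \<alpha> = k then Poly_Mapping.lookup p \<alpha> else 0)"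
  by (simp add: hom_part_def lookup_mapp in_keys_iff when_def)

lemma keys_hom_part: "Poly_Mapping.keys (hom_part k p) = {\<alpha> \<in> Poly_Mapping.keys p. expo_degree \<alpha> = k}"
  by (auto simp: in_keys_iff lookup_hom_part split: if_splits)

lemma expo_degree_eq_0: "expo_degree \<alpha> = 0 \<Longrightarrow> \<alpha> = 0"
  by (rule poly_mapping_eqI) (auto simp: expo_degree_def in_keys_iff)

lemma expo_degree_le_total: "\<alpha> \<in> Poly_Mapping.keys p \<Longrightarrow> expo_degree \<alpha> \<le> total_degree p"
  unfolding total_degree_def by (intro Max_ge) auto

lemma total_degree_eqI:
  assumes "\<And>\<beta>. \<beta> \<in> Poly_Mapping.keys p \<Longrightarrow> expo_degree \<beta> \<le> D"
    and "\<alpha> \<in> Poly_Mapping.keys p" "expo_degree \<alpha> = D"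
  shows "total_degree p = D"
  unfolding total_degree_def using assms by (intro Max_eqI) auto

lemma total_degree_attained:
  assumes "total_degree p \<ge> 1"
  obtains \<alpha> where "\<alpha> \<in> Poly_Mapping.keys p" "expo_degree \<alpha> = total_degree p"
proof -
  have "total_degree p \<in> insert 0 (expo_degree ` Poly_Mapping.keys p)"
    unfolding total_degree_def by (intro Max_in) auto
  then show thesis using assms that by auto
qed

lemma sum_hom_parts: "(\<Sum>k\<le>total_degree p. hom_part k p) = p"
proof (rule poly_mapping_eqI)
  fix \<alpha>
  have "Poly_Mapping.lookup (\<Sum>k\<le>total_degree p. hom_part k p) \<alpha>
      = (\<Sum>k\<le>total_degree p. if expo_degree \<alpha> = k then Poly_Mapping.lookup p \<alpha> else 0)"
    by (simp add: lookup_sum lookup_hom_part)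
  also have "\<dots> = (if expo_degree \<alpha> \<le> total_degree p then Poly_Mapping.lookup p \<alpha> else 0)" by simp
  also have "\<dots> = Poly_Mapping.lookup p \<alpha>"
    using expo_degree_le_total[of \<alpha> p] by (auto simp: in_keys_iff)
  finally show "Poly_Mapping.lookup (\<Sum>k\<le>total_degree p. hom_part k p) \<alpha> = Poly_Mapping.lookup p \<alpha>" .
qed

lemma num_terms_hom_parts: "num_terms p = (\<Sum>k\<le>total_degree p. card (Poly_Mapping.keys (hom_part k p)))"
proof -
  have eq: "Poly_Mapping.keys p = (\<Union>k\<le>total_degree p. Poly_Mapping.keys (hom_part k p))"
    using expo_degree_le_total by (auto simp: keys_hom_part)
  have "card (\<Union>k\<le>total_degree p. Poly_Mapping.keys (hom_part k p)) =
      (\<Sum>k\<le>total_degree p. card (Poly_Mapping.keys (hom_part k p)))"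
    by (rule card_UN_disjoint) (auto simp: keys_hom_part)
  then show ?thesis unfolding num_terms_def by (rule trans[OF arg_cong[of _ _ card, OF eq]])
qed

lemma hom_part_expos: "p \<in> polys_in n \<Longrightarrow> Poly_Mapping.keys (hom_part k p) \<subseteq> expos n k"
  by (auto simp: keys_hom_part polys_in_def expos_def)

lemma quot_part_expos:
  assumes "p \<in> polys_in n"
  shows "Poly_Mapping.keys (quot_part n p k) \<subseteq> expos n k"
proof (induction k)
  case 0
  have "Poly_Mapping.keys (quot_part n p 0) \<subseteq> Poly_Mapping.keys (1 :: rpoly) \<union> Poly_Mapping.keys (hom_part 0 p)"
    unfolding quot_part.simps by (rule keys_diff)
  moreover have "0 \<in> expos n 0" by (simp add: expos_def expo_degree_def)
  ultimately show ?case using hom_part_expos[OF assms, of 0] by auto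
next
  case (Suc k)
  have "Poly_Mapping.keys (quot_part n p (Suc k)) \<subseteq>
      Poly_Mapping.keys (coord_sum n * quot_part n p k) \<union> Poly_Mapping.keys (hom_part (Suc k) p)"
    unfolding quot_part.simps by (rule keys_diff)
  then show ?case using coord_sum_mult_expos[OF Suc] hom_part_expos[OF assms, of "Suc k"] by blast
qed

text \<open>
  On the hyperplane \<open>s = 1\<close> the recursion is a telescoping sum.
\<close>

lemma poly_eval_quot_part:
  assumes "(\<Sum>i<n. x i) = 1"
  shows "poly_eval (quot_part n p k) x = 1 - (\<Sum>l\<le>k. poly_eval (hom_part l p) x)"
  using assms by (induction k) (simp_all add: poly_eval_diff poly_eval_coord_sum_mult)

lemma poly_eval_scale:
  assumes "Poly_Mapping.keys g \<subseteq> expos n k"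
  shows "poly_eval g (\<lambda>i. t * x i) = t ^ k * poly_eval g x"
proof -
  have "mono_eval (\<lambda>i. t * x i) \<alpha> = t ^ k * mono_eval x \<alpha>" if "\<alpha> \<in> Poly_Mapping.keys g" for \<alpha>
  proof -
    have "mono_eval (\<lambda>i. t * x i) \<alpha> = t ^ expo_degree \<alpha> * mono_eval x \<alpha>"
      unfolding mono_eval_def expo_degree_def power_sum by (simp add: power_mult_distrib prod.distrib)
    then show ?thesis using assms that by (auto simp: expos_def)
  qed
  then show ?thesis
    by (simp add: poly_eval_superset[OF finite_keys order_refl] sum_distrib_left mult_ac)
qed

lemma potential_zero: "potential n B 0 = 0"
  by (simp add: potential_def num_tips_def edge_blocks_def)

lemma potential_single:
  assumes "n \<ge> 2" "a \<noteq> 0"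
  shows "potential n B (Poly_Mapping.single c a) = int n"
proof -
  let ?g = "Poly_Mapping.single c a"
  have nz: "?g \<noteq> 0" using assms by (metis keys_eq_empty keys_single insert_not_empty)
  have top_expo: "top_expo n B i j ?g = c" for i j using top_expo_in[OF nz, of n B i j] assms by simp
  have "edge_blocks n B i j ?g = 0" if "i \<noteq> j" for i j
  proof -
    have s: "line_coeffs i j c ?g x = (if x = Poly_Mapping.lookup c i then a else 0)" for x
    proof (cases "x = Poly_Mapping.lookup c i")
      case True
      then show ?thesis using that by (simp add: line_coeffs_self)
    next
      case False
      then have "line_point i j c x \<noteq> c" using lookup_line_point[of i j c x i] by auto
      then show ?thesis using False by (auto simp: line_coeffs_def lookup_single when_def)
    qed
    have "{x. line_coeffs i j c ?g x \<noteq> 0} = {Poly_Mapping.lookup c i}" using s assms by auto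
    moreover have "{x. line_coeffs i j c ?g x * line_coeffs i j c ?g (Suc x) < 0} = {}" using s by auto
    ultimately show ?thesis using nz by (simp add: edge_blocks_def top_expo alt_blocks_def)
  qed
  moreover have "num_tips n B i ?g = 1" if "i < n" for i
  proof -
    have "(if i = 0 then 1 else 0) \<in> {..<n} - {i}" using assms that by auto
    then have "(\<lambda>j. top_expo n B i j ?g) ` ({..<n} - {i}) = {c}" unfolding top_expo by blast
    then show ?thesis using nz by (simp add: num_tips_def)
  qed
  ultimately show ?thesis by (simp add: potential_def)
qed

locale H_poly =
  fixes n :: nat and p :: rpoly and d :: nat
  assumes n4: "n \<ge> 4" and pH: "p \<in> H_set n" and d_def: "d = total_degree p" and d1: "d \<ge> 1"
begin

abbreviation "q \<equiv> quot_part n p"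
abbreviation "B \<equiv> Suc d"

lemma p_in: "p \<in> polys_in n" and p_nonneg: "0 \<le> Poly_Mapping.lookup p \<alpha>"
  and p_eval: "(\<Sum>i<n. x i) = 1 \<Longrightarrow> poly_eval p x = 1"
  using pH by (auto simp: H_set_def)

lemma eval_parts: "poly_eval p x = (\<Sum>k\<le>d. poly_eval (hom_part k p) x)"
  unfolding d_def by (subst sum_hom_parts[symmetric]) (rule poly_eval_sum)

text \<open>
  On \<open>s = 1\<close> the form \<open>q d\<close> equals \<open>1 - p\<close> and vanishes; by homogeneity it vanishes at all positive points.
\<close>

lemma q_d: "q d = 0"
proof (rule poly_zero_if_eval_zero[OF quot_part_expos[OF p_in]])
  fix x :: "nat \<Rightarrow> real" assume pos: "\<And>i. x i > 0"
  define s where "s = (\<Sum>i<n. x i)"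
  have s: "s > 0" unfolding s_def using pos n4 by (intro sum_pos) (auto simp: lessThan_empty_iff)
  have "(\<Sum>i<n. inverse s * x i) = 1" using s by (simp add: s_def flip: sum_distrib_left)
  then have "poly_eval (q d) (\<lambda>i. inverse s * x i) = 0"
    using p_eval eval_parts by (simp add: poly_eval_quot_part)
  then show "poly_eval (q d) x = 0"
    using s poly_eval_scale[OF quot_part_expos[OF p_in], of d "inverse s" x] by simp
qed

text \<open>
  If \<open>q k = 0\<close>, the parts of \<open>p\<close> up to degree \<open>k\<close> sum to \<open>1\<close> on the hyperplane. The remaining parts then
  vanish at a positive point, which is impossible as their coefficients are non-negative and not all zero.
\<close>

lemma q_nonzero:
  assumes "k < d"
  shows "q k \<noteq> 0"
proof
  assume "q k = 0"
  \<comment> \<open>any point of the hyperplane with positive coordinates would do\<close>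
  define x where "x i = 1 / real n" for i :: nat
  have x: "(\<Sum>i<n. x i) = 1" using n4 by (simp add: x_def)
  have nonneg: "poly_eval (hom_part l p) x \<ge> 0" for l
    unfolding poly_eval_def using p_nonneg
    by (intro sum_nonneg mult_nonneg_nonneg prod_nonneg) (auto simp: lookup_hom_part x_def)
  obtain \<alpha> where \<alpha>: "\<alpha> \<in> Poly_Mapping.keys p" "expo_degree \<alpha> = d"
    using total_degree_attained d1 d_def by metis
  have "poly_eval (hom_part d p) x > 0"
    unfolding poly_eval_def
  proof (rule sum_pos2[of _ \<alpha>])
    show "\<alpha> \<in> Poly_Mapping.keys (hom_part d p)" using \<alpha> by (simp add: keys_hom_part)
    have "Poly_Mapping.lookup p \<alpha> > 0" using \<alpha>(1) p_nonneg[of \<alpha>] by (simp add: in_keys_iff)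
    then show "0 < Poly_Mapping.lookup (hom_part d p) \<alpha> * (\<Prod>i\<in>Poly_Mapping.keys \<alpha>. x i ^ Poly_Mapping.lookup \<alpha> i)"
      using \<alpha>(2) n4 by (intro mult_pos_pos prod_pos) (auto simp: lookup_hom_part x_def)
  qed (use p_nonneg in \<open>auto simp: lookup_hom_part x_def intro!: mult_nonneg_nonneg prod_nonneg\<close>)
  moreover have "poly_eval (hom_part d p) x \<le> (\<Sum>l\<in>{k<..d}. poly_eval (hom_part l p) x)"
    by (rule member_le_sum) (use assms nonneg in auto)
  moreover have "(\<Sum>l\<le>d. poly_eval (hom_part l p) x) =
      (\<Sum>l\<le>k. poly_eval (hom_part l p) x) + (\<Sum>l\<in>{k<..d}. poly_eval (hom_part l p) x)"
    using assms by (subst sum.union_disjoint[symmetric]) (auto intro: sum.cong)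
  moreover have "(\<Sum>l\<le>k. poly_eval (hom_part l p) x) = 1"
    using poly_eval_quot_part[OF x, of p k] \<open>q k = 0\<close> by simp
  ultimately show False using p_eval[OF x] eval_parts[of x] by linarith
qed

lemma q_step: "coord_sum n * q k - q (Suc k) = hom_part (Suc k) p"
  by simp

lemma q_le: "Poly_Mapping.lookup (q (Suc k)) \<beta> \<le> Poly_Mapping.lookup (coord_sum n * q k) \<beta>"
  using p_nonneg[of \<beta>] by (simp add: lookup_minus lookup_hom_part)

text \<open>
  Backward induction: positivity at the ends of the edges holds vacuously for \<open>q d = 0\<close>, makes the preceding
  pair of parts a growth step, and is passed on by \<open>top_pos\<close>. The base \<open>d + 1\<close> exceeds all exponents.
\<close>

lemma q_growth_step_and_top:
  assumes "k \<le> d"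
  shows "(k < d \<longrightarrow> growth_step n B k (q k) (q (Suc k))) \<and>
    (\<forall>i<n. \<forall>j<n. i \<noteq> j \<longrightarrow> q k \<noteq> 0 \<longrightarrow> Poly_Mapping.lookup (q k) (top_expo n B i j (q k)) > 0)"
  using assms
proof (induction k rule: inc_induct)
  case base
  then show ?case using q_d by simp
next
  case (step k)
  have gs: "growth_step n B k (q k) (q (Suc k))"
  proof
    show "Poly_Mapping.keys (q k) \<subseteq> expos n k" "Poly_Mapping.keys (q (Suc k)) \<subseteq> expos n (Suc k)"
      by (rule quot_part_expos[OF p_in])+
    show "0 < Poly_Mapping.lookup (q (Suc k)) (top_expo n B i j (q (Suc k)))"
      if "i < n" "j < n" "i \<noteq> j" "q (Suc k) \<noteq> 0" for i j
      using step.IH that by blast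
  qed (use n4 step q_nonzero q_le in auto)
  then show ?case using growth_step.top_pos by blast
qed

lemma q_growth_step: "k < d \<Longrightarrow> growth_step n B k (q k) (q (Suc k))"
  using q_growth_step_and_top[of k] by simp

definition "gap k = int n * int (card (Poly_Mapping.keys (hom_part (Suc k) p))) + potential n B (q (Suc k))
   - potential n B (q k) - int n * (int n - 1)"

lemma gap_nonneg: "k < d \<Longrightarrow> gap k \<ge> 0"
  using growth_step.step_bound[OF q_growth_step, of k] unfolding q_step gap_def by simp

lemma potential_q_0: "potential n B (q 0) = int n"
proof -
  have single: "q 0 = Poly_Mapping.single 0 (Poly_Mapping.lookup (q 0) 0)"
  proof (rule poly_mapping_eqI)
    fix \<alpha>
    show "Poly_Mapping.lookup (q 0) \<alpha> = Poly_Mapping.lookup (Poly_Mapping.single 0 (Poly_Mapping.lookup (q 0) 0)) \<alpha>"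
    proof (cases "\<alpha> = 0")
      case False
      then have "expo_degree \<alpha> \<noteq> 0" using expo_degree_eq_0 by blast
      then show ?thesis using False by (simp add: lookup_minus lookup_hom_part lookup_one lookup_single)
    qed simp
  qed
  moreover have "q 0 \<noteq> 0" by (rule q_nonzero) (use d1 in simp)
  ultimately have "Poly_Mapping.lookup (q 0) 0 \<noteq> 0" by (metis single_zero)
  then show ?thesis
    using potential_single[of n "Poly_Mapping.lookup (q 0) 0" B 0] n4 single by simp
qed

text \<open>
  The potential telescopes from \<open>n\<close> at \<open>q 0\<close> to \<open>0\<close> at \<open>q d\<close>. As the gaps are non-negative, this contains the
  bound \<open>N(p) \<ge> d (n - 1) + 1\<close>, with strict inequality if some gap is positive or \<open>p\<close> has a constant term.
\<close>

lemma sum_gap: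
  "(\<Sum>k<d. gap k) + int n * int (card (Poly_Mapping.keys (hom_part 0 p)))
    = int n * (int (num_terms p) - 1 - int d * (int n - 1))"
proof -
  have "(\<Sum>k<d. gap k) = int n * int (\<Sum>k<d. card (Poly_Mapping.keys (hom_part (Suc k) p)))
      + (\<Sum>k<d. potential n B (q (Suc k)) - potential n B (q k)) - int d * (int n * (int n - 1))"
    unfolding gap_def by (simp add: sum.distrib sum_subtractf sum_distrib_left)
  moreover have "(\<Sum>k<d. potential n B (q (Suc k)) - potential n B (q k)) = - int n"
    using sum_lessThan_telescope[of "\<lambda>k. potential n B (q k)" d]
    by (simp only: q_d potential_zero potential_q_0 diff_0)
  moreover have "num_terms p = card (Poly_Mapping.keys (hom_part 0 p))
      + (\<Sum>k<d. card (Poly_Mapping.keys (hom_part (Suc k) p)))"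
    unfolding num_terms_hom_parts d_def by (simp add: sum.atMost_shift)
  ultimately show ?thesis by (simp add: algebra_simps)
qed

end

locale sharp_H_poly = H_poly +
  assumes sharp: "num_terms p = d * (n - 1) + 1"
begin

lemma gap_zero: "k < d \<Longrightarrow> gap k = 0" and hom_part_0: "hom_part 0 p = 0"
proof -
  have "int (num_terms p) - 1 - int d * (int n - 1) = 0"
    using sharp n4 by (simp add: of_nat_diff)
  then have "(\<Sum>k<d. gap k) + int n * int (card (Poly_Mapping.keys (hom_part 0 p))) = 0"
    using sum_gap by simp
  moreover have "(\<Sum>k<d. gap k) \<ge> 0" by (intro sum_nonneg) (use gap_nonneg in auto)
  moreover have "int n * int (card (Poly_Mapping.keys (hom_part 0 p))) \<ge> 0" by simp
  ultimately have z: "(\<Sum>k<d. gap k) = 0" "int n * int (card (Poly_Mapping.keys (hom_part 0 p))) = 0"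
    by linarith+
  show "k < d \<Longrightarrow> gap k = 0"
    using z(1) by (subst (asm) sum_nonneg_eq_0_iff) (use gap_nonneg in auto)
  show "hom_part 0 p = 0" using z(2) n4 by simp
qed

lemma q_monomial_if_next:
  assumes k: "k < d" and c': "Poly_Mapping.keys (q (Suc k)) \<subseteq> {c'}"
  shows "\<exists>c a. a > 0 \<and> q k = Poly_Mapping.single c a"
proof -
  interpret growth_step n B k "q k" "q (Suc k)" using q_growth_step[OF k] .
  interpret tight_step n B k "q k" "q (Suc k)" c'
  proof
    show "int n * (int n - 1) + potential n B (q k) =
      potential n B (q (Suc k)) + int n * int (card (Poly_Mapping.keys (coord_sum n * q k - q (Suc k))))"
      using gap_zero[OF k] unfolding gap_def q_step by simp
  qed (rule c')
  show ?thesis by (rule g_monomial)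
qed

lemma q_monomial:
  assumes "k < d"
  shows "\<exists>c a. a > 0 \<and> q k = Poly_Mapping.single c a"
proof -
  have "\<exists>c. Poly_Mapping.keys (q k) \<subseteq> {c}" if "k \<le> d" for k
    using that
  proof (induction k rule: inc_induct)
    case base
    then show ?case by (simp add: q_d del: quot_part.simps)
  next
    case (step k)
    then obtain c' where "Poly_Mapping.keys (q (Suc k)) \<subseteq> {c'}" by blast
    then obtain c a where "q k = Poly_Mapping.single c a" using q_monomial_if_next step by blast
    then show ?case by auto
  qed
  then obtain c' where "Poly_Mapping.keys (q (Suc k)) \<subseteq> {c'}" using assms by (meson Suc_leI)
  then show ?thesis by (rule q_monomial_if_next[OF assms])
qed

lemma q_0: "q 0 = 1" by (simp add: hom_part_0)

text \<open>
  Both potentials in a tight step between monomials are \<open>n\<close>, so exactly \<open>n - 1\<close> terms are subtracted. If the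
  coefficient changed, the term of \<open>s q\<^sub>k\<close> that remains would be reduced but not removed, and \<open>n\<close> terms would
  be subtracted.
\<close>

lemma q_coeff_one:
  assumes "k < d"
  shows "\<exists>c. q k = Poly_Mapping.single c 1"
  using assms
proof (induction k)
  case 0
  then show ?case using q_0 by (metis single_one)
next
  case (Suc k)
  then obtain c where c: "q k = Poly_Mapping.single c 1" by auto
  obtain c' a where a: "a > 0" "q (Suc k) = Poly_Mapping.single c' a" using q_monomial Suc by blast
  let ?P = "hom_part (Suc k) p"
  have P: "Poly_Mapping.lookup ?P \<beta> = (if \<exists>i<n. \<beta> = c + var i then 1 else 0) - (if c' = \<beta> then a else 0)" for \<beta>
    unfolding q_step[symmetric] lookup_minus a(2) c lookup_coord_sum_single by (simp add: lookup_single when_def)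
  have card_n: "card ((\<lambda>i. c + var i) ` {..<n}) = n" by (subst card_image) (auto simp: inj_on_def)
  have "int n * (int n - 1) + int n = int n + int n * int (card (Poly_Mapping.keys ?P))"
    using gap_zero[of k] Suc.prems potential_single[of n 1 B c] potential_single[of n a B c'] a n4
    unfolding gap_def c a(2) by simp
  then have card_P: "card (Poly_Mapping.keys ?P) = n - 1" using n4 by simp
  have "Poly_Mapping.lookup ?P c' \<ge> 0" using p_nonneg by (simp add: lookup_hom_part)
  then have c'_in: "\<exists>i<n. c' = c + var i" using P[of c'] a(1) by (auto split: if_splits)
  have "a = 1"
  proof (rule ccontr)
    assume "a \<noteq> 1"
    have "\<beta> \<in> Poly_Mapping.keys ?P \<longleftrightarrow> (\<exists>i<n. \<beta> = c + var i)" for \<beta>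
    proof (cases "\<exists>i<n. \<beta> = c + var i")
      case True
      then show ?thesis using \<open>a \<noteq> 1\<close> unfolding in_keys_iff P by simp
    next
      case False
      then have "c' \<noteq> \<beta>" using c'_in by blast
      then show ?thesis using False unfolding in_keys_iff P by simp
    qed
    then have "Poly_Mapping.keys ?P = (\<lambda>i. c + var i) ` {..<n}" by auto
    then show False using card_P card_n n4 by simp
  qed
  then show ?case using a by blast
qed

text \<open>
  Stopping the recursion at degree \<open>k\<close> and keeping all of \<open>s q\<^sub>k\<^sub>-\<^sub>1\<close> as the part of degree \<open>k\<close> gives the
  polynomials that occur in the construction of \<open>p\<close> as a generalized Whitney polynomial.
\<close>

definition "truncated k = (\<Sum>l\<le>k. hom_part l p) + q k"

lemma truncated_whitney:
  assumes "1 \<le> k" "k \<le> d"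
  shows "sharp_whitney n (truncated k)"
  using assms
proof (induction k rule: dec_induct)
  case base
  have "truncated 1 = coord_sum n" using q_0 by (simp add: truncated_def hom_part_0)
  then show ?case using start by simp
next
  case (step k)
  then have kd: "k < d" and IH: "sharp_whitney n (truncated k)" by auto
  obtain c where c: "q k = Poly_Mapping.single c 1" using q_coeff_one[OF kd] by auto
  obtain k' where k': "k = Suc k'" using step by (cases k) auto
  obtain c'' where c'': "q k' = Poly_Mapping.single c'' 1" using q_coeff_one[of k'] kd k' by auto
  have "c \<in> Poly_Mapping.keys (q k)" by (simp add: c)
  then have deg_c: "expo_degree c = k" using quot_part_expos[OF p_in, of k] by (auto simp: expos_def)
  have "Poly_Mapping.lookup (\<Sum>l\<le>k. hom_part l p) c = Poly_Mapping.lookup p c"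
    by (simp add: lookup_sum lookup_hom_part deg_c)
  then have R1: "Poly_Mapping.lookup (truncated k) c = Poly_Mapping.lookup p c + 1"
    by (simp add: truncated_def lookup_add c)
  also have "\<dots> = Poly_Mapping.lookup (coord_sum n * q k') c"
  proof -
    have "coord_sum n * q k' = q k + hom_part k p" unfolding k' by simp
    then show ?thesis by (simp add: lookup_add lookup_hom_part deg_c c del: quot_part.simps)
  qed
  also have "\<dots> \<le> 1" unfolding c'' by (simp add: lookup_coord_sum_single)
  finally have Rc: "Poly_Mapping.lookup (truncated k) c = 1" using R1 p_nonneg[of c] by simp
  have "total_degree (truncated k) = k"
  proof (rule total_degree_eqI[OF _ _ deg_c])
    show "c \<in> Poly_Mapping.keys (truncated k)" by (simp add: in_keys_iff Rc)
    fix \<beta> assume "\<beta> \<in> Poly_Mapping.keys (truncated k)"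
    then have "Poly_Mapping.lookup (\<Sum>l\<le>k. hom_part l p) \<beta> \<noteq> 0 \<or> \<beta> \<in> Poly_Mapping.keys (q k)"
      by (auto simp: truncated_def in_keys_iff lookup_add)
    then show "expo_degree \<beta> \<le> k"
      using quot_part_expos[OF p_in, of k] by (auto simp: lookup_sum lookup_hom_part expos_def split: if_splits)
  qed
  then have "sharp_whitney n (truncated k - q k + coord_sum n * q k)"
    using IH deg_c Rc c by (intro sharp_whitney.step[of n "truncated k" c]) auto
  also have "truncated k - q k + coord_sum n * q k = truncated (Suc k)" by (simp add: truncated_def)
  finally show ?case .
qed

lemma p_whitney: "sharp_whitney n p"
proof -
  have "truncated d = p" using q_d sum_hom_parts[of p] by (simp add: truncated_def d_def)
  then show ?thesis using truncated_whitney[of d] d1 by simp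
qed

end

text \<open>
  The new terms have a larger degree than all others, so nothing is merged with them.
\<close>

lemma whitney_count:
  assumes "sharp_whitney n p" "n \<ge> 1"
  shows "num_terms p = total_degree p * (n - 1) + 1"
  using assms(1)
proof induction
  case start
  have "Poly_Mapping.lookup (coord_sum n) \<beta> = (if \<exists>i<n. \<beta> = var i then 1 else 0)" for \<beta>
    using lookup_coord_sum_single[of n 0 1 \<beta>] by simp
  then have keys: "Poly_Mapping.keys (coord_sum n) = var ` {..<n}" by (auto simp: in_keys_iff split: if_splits)
  then have "total_degree (coord_sum n) = 1"
    by (intro total_degree_eqI[of _ _ "var 0"]) (use assms(2) in auto)
  moreover have "card (var ` {..<n}) = n" by (subst card_image) (auto simp: inj_on_def)
  ultimately show ?case using keys assms(2) by (simp add: num_terms_def)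
next
  case (step p \<alpha> m)
  let ?p = "p - m + coord_sum n * m"
  let ?a = "Poly_Mapping.lookup p \<alpha>" and ?d = "total_degree p"
  let ?new = "(\<lambda>i. \<alpha> + var i) ` {..<n}"
  have l: "Poly_Mapping.lookup ?p \<beta> = (if \<beta> = \<alpha> then 0 else Poly_Mapping.lookup p \<beta>) + (if \<beta> \<in> ?new then ?a else 0)" for \<beta>
    unfolding lookup_add lookup_minus step(4) lookup_coord_sum_single by (auto simp: lookup_single when_def)
  have deg: "expo_degree \<beta> = Suc ?d" if "\<beta> \<in> ?new" for \<beta>
    using that step(2) by (auto simp: expo_degree_plus)
  then have old: "\<beta> \<notin> Poly_Mapping.keys p" if "\<beta> \<in> ?new" for \<beta>
    using that expo_degree_le_total[of \<beta> p] by fastforce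
  then have keys: "Poly_Mapping.keys ?p = (Poly_Mapping.keys p - {\<alpha>}) \<union> ?new"
    using step(3) by (auto simp: in_keys_iff l split: if_splits)
  have "\<alpha> \<in> Poly_Mapping.keys p" using step(3) by (simp add: in_keys_iff)
  moreover have "card ?new = n" by (subst card_image) (auto simp: inj_on_def)
  moreover have "(Poly_Mapping.keys p - {\<alpha>}) \<inter> ?new = {}" using old by blast
  ultimately have "num_terms ?p = num_terms p - 1 + n"
    unfolding num_terms_def keys by (subst card_Un_disjoint) auto
  moreover have "total_degree ?p = Suc ?d"
  proof (rule total_degree_eqI[of _ _ "\<alpha> + var 0"])
    show "expo_degree \<beta> \<le> Suc ?d" if "\<beta> \<in> Poly_Mapping.keys ?p" for \<beta>
      using that deg expo_degree_le_total[of \<beta> p] unfolding keys by fastforce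
    have "\<alpha> + var 0 \<in> ?new" using assms(2) by auto
    then show "\<alpha> + var 0 \<in> Poly_Mapping.keys ?p" "expo_degree (\<alpha> + var 0) = Suc ?d"
      using deg unfolding keys by blast+
  qed
  ultimately show ?case using step.IH assms(2) by simp
qed

theorem theorem2p1:
  fixes n :: nat and p :: rpoly
  assumes "n \<ge> 4"
    and "p \<in> H_set n"
    and "total_degree p \<ge> 1"
  shows "real (total_degree p) = (real (num_terms p) - 1) / (real n - 1) \<longleftrightarrow> sharp_whitney n p"
proof -
  have "real (total_degree p) = (real (num_terms p) - 1) / (real n - 1) \<longleftrightarrow>
      real (total_degree p * (n - 1) + 1) = real (num_terms p)"
    using assms(1) by (auto simp: of_nat_diff field_simps)
  also have "\<dots> \<longleftrightarrow> num_terms p = total_degree p * (n - 1) + 1" by (metis of_nat_eq_iff)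
  also have "\<dots> \<longleftrightarrow> sharp_whitney n p"
  proof
    assume "num_terms p = total_degree p * (n - 1) + 1"
    then interpret sharp_H_poly n p "total_degree p" using assms by unfold_locales auto
    show "sharp_whitney n p" by (rule p_whitney)
  next
    assume "sharp_whitney n p"
    then show "num_terms p = total_degree p * (n - 1) + 1" using whitney_count assms(1) by simp
  qed
  finally show ?thesis .
qed

end
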